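(* Let $\varphi_1=\tfrac12\varphi$, where $\varphi$ is a Jacob's ladder, and let $\tilde Z^2(t)=\frac{d\varphi_1(t)}{dt}$. There is a constant $T_0=T_0[\varphi_1]$ such that for every $T\ge T_0$ the following holds. Let $\mathring{T}=\varphi_1^{-1}(T)$ and $\mathring{(T+2)}=\varphi_1^{-1}(T+2)$, so that $\varphi_1$ maps $[\mathring{T},\mathring{(T+2)}]$ onto $[T,T+2]$. Then for all real $\alpha,\beta>-1$ the functions $$P^{(\alpha,\beta)}_n(\varphi_1(t)-T-1),\qquad t\in[\mathring{T},\mathring{(T+2)}],\quad n=0,1,2,\dots,$$ form an orthogonal system on $[\mathring{T},\mathring{(T+2)}]$ with weight function $(T+2-\varphi_1(t))^\alpha(\varphi_1(t)-T)^\beta\tilde Z^2(t)$; that is, $\varphi_1(t)-T-1\in[-1,1]$ on this segment and, for all $m,n\in\{0,1,2,\dots\}$, $$\int_{\mathring{T}}^{\mathring{(T+2)}}P^{(\alpha,\beta)}_m(\varphi_1(t)-T-1)\,P^{(\alpha,\beta)}_n(\varphi_1(t)-T-1)\,(T+2-\varphi_1(t))^\alpha(\varphi_1(t)-T)^\beta\,\tilde Z^2(t)\,dt=0\quad (m\neq n),$$ $$\int_{\mathring{T}}^{\mathring{(T+2)}}\left[P^{(\alpha,\beta)}_n(\varphi_1(t)-T-1)\right]^2(T+2-\varphi_1(t))^\alpha(\varphi_1(t)-T)^\beta\,\tilde Z^2(t)\,dt=\frac{2^{\alpha+\beta+1}}{2n+\alpha+\beta+1}\,\frac{\Gamma(n+\alpha+1)\Gamma(n+\beta+1)}{n!\,\Gamma(n+\alpha+\beta+1)}.$$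 Moreover, denoting by $\rho\{A;B\}$ the distance between two segments $A,B\subset\mathbb{R}$, $$\rho\{[-1,1];[\mathring{T},\mathring{(T+2)}]\}\sim T,\qquad T\to\infty.$$
   Context: Hardy's function: $Z(t)=e^{i\vartheta(t)}\zeta(\tfrac12+it)$ with $\vartheta(t)=-\tfrac t2\ln\pi+\operatorname{Im}\ln\Gamma(\tfrac14+i\tfrac t2)$, where $\zeta$ is the Riemann zeta-function; thus $Z$ is real-valued and $Z^2(t)=|\zeta(\tfrac12+it)|^2$. Jacob's ladder: fix an infinitely differentiable, increasing, unbounded function $\mu:[y_0,\infty)\to\mathbb{R}$ with $\mu(y)\ge 7y\ln y$. The Jacob's ladder $\varphi$ (associated with $\mu$) is the solution $X(T)=\varphi(T)$, defined for all sufficiently large $T$, of the nonlinear integral equation $$\int_0^{\mu[X(T)]}Z^2(t)e^{-\frac{2}{X(T)}t}\,dt=\int_0^T Z^2(t)\,dt .$$ Put $\varphi_1(t)=\tfrac12\varphi(t)$. For large $t$ the function $\varphi_1$ is continuously differentiable, strictly increasing and unbounded, so it has an inverse $\varphi_1^{-1}$ on a half-line; its derivative is denoted $\tilde Z^2(t)=\frac{d\varphi_1(t)}{dt}$. With $\Phi(y)=\int_0^{\mu(y)}Z^2(t)e^{-2t/y}\,dt$ one has $\tilde Z^2(t)=\frac{Z^2(t)}{2\Phi'(\varphi(t))}$. Standing facts on Jacob's ladders (from earlier work, part of the setting): $$\tilde Z^2(t)=\frac{|\zeta(\frac12+it)|^2}{\left\{1+\mathcal{O}\left(\frac{\ln\ln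 t}{\ln t}\right)\right\}\ln t},\qquad t-\varphi_1(t)\sim(1-c)\pi(t)\quad(t\to\infty),$$ where $c$ is Euler's constant and $\pi(t)$ is the prime-counting function. Jacobi polynomials: for $\alpha,\beta>-1$ and $n=0,1,2,\dots$, $P_n^{(\alpha,\beta)}$ is defined by $$(1-x)^\alpha(1+x)^\beta P^{(\alpha,\beta)}_n(x)=\frac{(-1)^n}{2^nn!}\frac{d^n}{dx^n}\left[(1-x)^{\alpha+n}(1+x)^{\beta+n}\right].$$ Convention: when $n=0$ the product $(\alpha+\beta+1)\Gamma(\alpha+\beta+1)$ is read as $\Gamma(\alpha+\beta+2)$ (relevant when $\alpha+\beta=-1$). *)

theory Defs
  imports
    "HOL-Complex_Analysis.Complex_Analysis"
    "HOL-Computational_Algebra.Polynomial"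
    "HOL-Computational_Algebra.Primes"
    "HOL-Library.Landau_Symbols"
begin

text \<open>
  The Riemann zeta function enters only through its values on the critical line, so it is
  introduced as the analytic continuation of the Dirichlet series to the half-plane
  $\mathrm{Re}\,s > 0$ punctured at $1$.
\<close>

definition is_zeta_continuation :: "(complex \<Rightarrow> complex) \<Rightarrow> bool" where
  "is_zeta_continuation f \<longleftrightarrow>
     f holomorphic_on ({s. 0 < Re s} - {1}) \<and>
     (\<forall>s. 1 < Re s \<longrightarrow> (\<lambda>n. 1 / of_nat (Suc n) powr s) sums f s)"

definition zeta :: "complex \<Rightarrow> complex" where
  "zeta = (SOME f. is_zeta_continuation f)"

lemma zeta_term_bound:
  fixes s :: complex and N :: nat
  assumes "0 < Re s" "s \<noteq> 1" "0 < N"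
  shows "norm (of_nat N powr (-s) - (of_nat (Suc N) powr (1 - s) - of_nat N powr (1 - s)) / (1 - s))
           \<le> norm s * real N powr (- Re s - 1)"
proof -
  define S where "S = closed_segment (of_nat N :: complex) (of_nat (Suc N))"
  define h where "h = (\<lambda>x::complex. x * of_nat N powr (-s) - x powr (1 - s) / (1 - s))"
  define B where "B = norm s * real N powr (- Re s - 1)"
  have S_iff: "\<exists>r::real. x = of_real r \<and> real N \<le> r \<and> r \<le> real N + 1" if "x \<in> S" for x
  proof -
    from that obtain u where u: "0 \<le> u" "u \<le> 1"
      "x = (1 - u) *\<^sub>R of_nat N + u *\<^sub>R of_nat (Suc N)"
      unfolding S_def closed_segment_def by blast
    have "x = of_real (real N + u)"
      unfolding u(3) by (simp add: scaleR_conv_of_real algebra_simps)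
    thus ?thesis using u by (intro exI[of _ "real N + u"]) auto
  qed
  have nn: "x \<notin> \<real>\<^sub>\<le>\<^sub>0" "x \<noteq> 0" if "x \<in> S" for x
    using S_iff[OF that] assms(3) by auto
  have cvx: "convex S" by (simp add: S_def)
  have ends: "of_nat N \<in> S" "of_nat (Suc N) \<in> S" by (simp_all add: S_def)
  have nB: "norm (of_nat N powr (-s) - x powr (-s)) \<le> B" if x: "x \<in> S" for x :: complex
  proof -
    have "norm (of_nat N powr (-s) - x powr (-s)) \<le> B * norm (of_nat N - x)"
    proof (rule field_differentiable_bound[where f = "\<lambda>z. z powr (-s)"
          and f' = "\<lambda>z. (-s) * z powr (-s - 1)", OF cvx _ _ ends(1) x])
      fix z assume z: "z \<in> S"
      show "((\<lambda>z. z powr (-s)) has_field_derivative (-s) * z powr (-s - 1)) (at z within S)"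
        by (rule has_field_derivative_at_within[OF has_field_derivative_powr[OF nn(1)[OF z]]])
      obtain r where r: "z = of_real r" "real N \<le> r" using S_iff[OF z] by blast
      have "norm (z powr (-s - 1)) = r powr (- Re s - 1)"
        using r assms(3) by (simp add: norm_powr_real_powr)
      also have "\<dots> \<le> real N powr (- Re s - 1)"
        using r assms by (intro powr_mono2') auto
      finally show "norm ((-s) * z powr (-s - 1)) \<le> B"
        by (simp add: norm_mult B_def mult_left_mono)
    qed
    also have "norm (of_nat N - x) \<le> 1"
    proof -
      obtain r where r: "x = of_real r" "real N \<le> r" "r \<le> real N + 1" using S_iff[OF x] by blast
      have "of_nat N - x = of_real (real N - r)" using r by simp
      hence "norm (of_nat N - x) = \<bar>real N - r\<bar>" by (simp only: norm_of_real)
      thus ?thesis using r by simp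
    qed
    hence "B * norm (of_nat N - x) \<le> B * 1"
      by (intro mult_left_mono) (auto simp: B_def)
    finally show ?thesis by simp
  qed
  have "norm (h (of_nat (Suc N)) - h (of_nat N)) \<le> B * norm (of_nat (Suc N) - of_nat N :: complex)"
  proof (rule field_differentiable_bound[where f = h
        and f' = "\<lambda>z. of_nat N powr (-s) - z powr (-s)", OF cvx _ _ ends(2) ends(1)])
    fix z assume z: "z \<in> S"
    have "(h has_field_derivative (1 * of_nat N powr (-s) - (1 - s) * z powr (1 - s - 1) / (1 - s))) (at z)"
      unfolding h_def
      by (intro DERIV_diff DERIV_cmult_right DERIV_cdivide DERIV_ident has_field_derivative_powr nn(1)[OF z])
    thus "(h has_field_derivative (of_nat N powr (-s) - z powr (-s))) (at z within S)"
      using assms by (simp add: has_field_derivative_at_within)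
    show "norm (of_nat N powr (-s) - z powr (-s)) \<le> B" by (rule nB[OF z])
  qed
  moreover have "h (of_nat (Suc N)) - h (of_nat N) =
     of_nat N powr (-s) - (of_nat (Suc N) powr (1 - s) - of_nat N powr (1 - s)) / (1 - s)"
    by (simp add: h_def algebra_simps diff_divide_distrib)
  ultimately show ?thesis by (simp add: B_def)
qed

lemma zeta_continuation_exists: "\<exists>f. is_zeta_continuation f"
proof -
  define U where "U = {s. 0 < Re s} - {1::complex}"
  define a where "a = (\<lambda>n s. of_nat (Suc n) powr (-s) -
     (of_nat (Suc (Suc n)) powr (1 - s) - of_nat (Suc n) powr (1 - s)) / (1 - s) :: complex)"
  define f where "f = (\<lambda>s. 1 / (s - 1) + (\<Sum>n. a n s))"
  have opU: "open U" unfolding U_def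
    by (intro open_Diff open_halfspace_Re_gt) auto
  have bound: "norm (a n s) \<le> norm s * real (Suc n) powr (- Re s - 1)" if "s \<in> U" for n s
    using zeta_term_bound[of s "Suc n"] that unfolding a_def U_def by simp
  have "(\<lambda>s. \<Sum>n. a n s) holomorphic_on U"
  proof (rule holomorphic_uniform_sequence[OF opU])
    show "(\<lambda>s. \<Sum>i<n. a i s) holomorphic_on U" for n
      unfolding a_def by (intro holomorphic_intros) (auto simp: U_def simp del: of_nat_Suc)
  next
    fix z assume z: "z \<in> U"
    obtain d where d: "d > 0" "cball z d \<subseteq> U"
      using opU z open_contains_cball by blast
    have "z - of_real d \<in> cball z d" using d(1) by (simp add: dist_norm)
    hence "z - of_real d \<in> U" using d(2) by blast
    hence dl: "0 < Re z - d" by (simp add: U_def)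
    have "uniform_limit (cball z d) (\<lambda>n s. \<Sum>i<n. a i s) (\<lambda>s. \<Sum>n. a n s) sequentially"
    proof (rule Weierstrass_m_test)
      fix n s assume s: "s \<in> cball z d"
      have "Re (z - s) \<le> norm (z - s)" by (rule complex_Re_le_cmod)
      hence re: "Re z - d \<le> Re s" using s by (simp add: dist_norm)
      have "norm s \<le> norm z + norm (z - s)" by (metis norm_minus_commute norm_triangle_sub)
      hence "norm s \<le> norm z + d" using s by (simp add: dist_norm)
      moreover have "real (Suc n) powr (- Re s - 1) \<le> real (Suc n) powr (- (Re z - d) - 1)"
        using re by (intro powr_mono) auto
      ultimately have "norm s * real (Suc n) powr (- Re s - 1)
          \<le> (norm z + d) * real (Suc n) powr (- (Re z - d) - 1)"
        using d(1) by (intro mult_mono) auto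
      thus "norm (a n s) \<le> (norm z + d) * real (Suc n) powr (- (Re z - d) - 1)"
        using bound[of s n] s d(2) by fastforce
    next
      have "summable (\<lambda>n. real n powr (- (Re z - d) - 1))"
        using dl by (subst summable_real_powr_iff) auto
      hence "summable (\<lambda>n. real (Suc n) powr (- (Re z - d) - 1))"
        by (subst summable_Suc_iff)
      thus "summable (\<lambda>n. (norm z + d) * real (Suc n) powr (- (Re z - d) - 1))"
        by (rule summable_mult)
    qed
    thus "\<exists>d. 0 < d \<and> cball z d \<subseteq> U \<and>
        uniform_limit (cball z d) (\<lambda>n s. \<Sum>i<n. a i s) (\<lambda>s. \<Sum>n. a n s) sequentially"
      using d by blast
  qed
  hence hol: "f holomorphic_on U"
    unfolding f_def by (intro holomorphic_intros) (auto simp: U_def)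
  have sums: "(\<lambda>n. 1 / of_nat (Suc n) powr s) sums f s" if s: "1 < Re s" for s
  proof -
    have sU: "s \<in> U" using s by (auto simp: U_def)
    have s1: "1 - s \<noteq> 0" using s by auto
    have "summable (\<lambda>n. real (Suc n) powr (- Re s - 1))"
      using s by (subst summable_Suc_iff, subst summable_real_powr_iff) auto
    hence "summable (\<lambda>n. norm s * real (Suc n) powr (- Re s - 1))" by (rule summable_mult)
    hence "summable (\<lambda>n. a n s)"
      by (rule summable_comparison_test'[where N = 0]) (rule bound[OF sU])
    hence A: "(\<lambda>n. a n s) sums (\<Sum>n. a n s)" by (rule summable_sums)
    have "(\<lambda>n. of_nat (Suc n) powr (1 - s) :: complex) \<longlonglongrightarrow> 0"
    proof (rule tendsto_norm_zero_cancel)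
      have eq: "norm (of_nat (Suc n) powr (1 - s) :: complex) = real (Suc n) powr (1 - Re s)" for n
        using norm_powr_real_powr[of "of_nat (Suc n)" "1 - s"] by simp
      have "filterlim (\<lambda>n. real (Suc n)) at_top sequentially"
        by (rule filterlim_compose[OF filterlim_real_sequentially filterlim_Suc])
      hence "(\<lambda>n. real (Suc n) powr (1 - Re s)) \<longlonglongrightarrow> 0"
        using s by (intro tendsto_neg_powr) auto
      thus "(\<lambda>n. norm (of_nat (Suc n) powr (1 - s) :: complex)) \<longlonglongrightarrow> 0"
        unfolding eq .
    qed
    from telescope_sums[OF this]
    have "(\<lambda>n. of_nat (Suc (Suc n)) powr (1 - s) - of_nat (Suc n) powr (1 - s) :: complex) sums (-1)"
      by simp
    from sums_divide[OF this, of "1 - s"] and A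
    have "(\<lambda>n. a n s + (of_nat (Suc (Suc n)) powr (1 - s) - of_nat (Suc n) powr (1 - s)) / (1 - s))
            sums ((\<Sum>n. a n s) + (-1) / (1 - s))"
      by (intro sums_add)
    moreover have "(-1) / (1 - s) = 1 / (s - 1)"
      by (metis minus_diff_eq minus_divide_left minus_divide_right)
    moreover have "a n s + (of_nat (Suc (Suc n)) powr (1 - s) - of_nat (Suc n) powr (1 - s)) / (1 - s)
        = 1 / of_nat (Suc n) powr s" for n
      unfolding a_def powr_minus_divide by simp
    ultimately show ?thesis
      unfolding f_def by (simp only: add.commute)
  qed
  show ?thesis
    using hol sums unfolding is_zeta_continuation_def U_def by blast
qed

lemma zeta_continuation_unique:
  assumes "is_zeta_continuation f" "is_zeta_continuation g" "0 < Re s" "s \<noteq> 1"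
  shows "f s = g s"
proof -
  let ?U = "{s. 0 < Re s} - {1::complex}" and ?V = "{s. 1 < Re s}"
  have "open ?U" by (intro open_Diff open_halfspace_Re_gt) auto
  moreover have "connected ?U"
    by (intro connected_open_delete open_halfspace_Re_gt convex_connected convex_halfspace_Re_gt) auto
  moreover have "open ?V" by (rule open_halfspace_Re_gt)
  moreover have "(2::complex) \<in> ?V" by simp
  hence "?V \<noteq> {}" by blast
  moreover have "?V \<subseteq> ?U" by auto
  moreover have "f z = g z" if "z \<in> ?V" for z
    using assms that unfolding is_zeta_continuation_def by (auto intro: sums_unique2)
  moreover have "f holomorphic_on ?U" "g holomorphic_on ?U" "s \<in> ?U"
    using assms unfolding is_zeta_continuation_def by auto
  ultimately show ?thesis
    using analytic_continuation_open[of ?V ?U f g s] by blast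
qed

lemma zeta_continuation_zeta: "is_zeta_continuation zeta"
  unfolding zeta_def by (rule someI_ex[OF zeta_continuation_exists])

definition hardy_theta :: "real \<Rightarrow> real" where
  "hardy_theta t = - (t / 2) * ln pi + Im (ln_Gamma (Complex (1/4) (t / 2)))"

text \<open>
  Hardy's function is kept complex-valued. Since it takes only real values, $Z(t)^2$ is rendered
  below as the real number \<open>(norm (hardy_Z t))\<^sup>2\<close>.
\<close>

definition hardy_Z :: "real \<Rightarrow> complex" where
  "hardy_Z t = exp (\<i> * of_real (hardy_theta t)) * zeta (Complex (1/2) t)"

lemma norm_hardy_Z: "norm (hardy_Z t) = norm (zeta (Complex (1/2) t))"
  by (simp add: hardy_Z_def norm_mult)

text \<open>The derivatives in \<open>smooth_on_halfline\<close> are one-sided at the endpoint.\<close>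

definition smooth_on_halfline :: "real \<Rightarrow> (real \<Rightarrow> real) \<Rightarrow> bool" where
  "smooth_on_halfline y0 f \<longleftrightarrow>
     (\<exists>D :: nat \<Rightarrow> real \<Rightarrow> real. (\<forall>y\<ge>y0. D 0 y = f y) \<and>
        (\<forall>k. \<forall>y\<ge>y0. (D k has_real_derivative D (Suc k) y) (at y within {y0..})))"

definition admissible_mu :: "real \<Rightarrow> (real \<Rightarrow> real) \<Rightarrow> bool" where
  "admissible_mu y0 \<mu> \<longleftrightarrow> 0 < y0 \<and> smooth_on_halfline y0 \<mu> \<and> mono_on {y0..} \<mu> \<and>
     \<not> bdd_above (\<mu> ` {y0..}) \<and> (\<forall>y\<ge>y0. \<mu> y \<ge> 7 * y * ln y)"

definition jacob_ladder :: "real \<Rightarrow> (real \<Rightarrow> real) \<Rightarrow> real \<Rightarrow> (real \<Rightarrow> real) \<Rightarrow> bool" where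
  "jacob_ladder y0 \<mu> t0 \<phi> \<longleftrightarrow> 0 < t0 \<and>
     (\<forall>T\<ge>t0. \<phi> T \<ge> y0 \<and>
        integral {0..\<mu> (\<phi> T)} (\<lambda>t. (norm (hardy_Z t))\<^sup>2 * exp (- (2 / \<phi> T) * t)) =
        integral {0..T} (\<lambda>t. (norm (hardy_Z t))\<^sup>2))"

definition prime_counting :: "real \<Rightarrow> real" where
  "prime_counting x = real (card {p::nat. prime p \<and> real p \<le> x})"

definition is_jacobi_poly :: "real \<Rightarrow> real \<Rightarrow> nat \<Rightarrow> real poly \<Rightarrow> bool" where
  "is_jacobi_poly \<alpha> \<beta> n p \<longleftrightarrow>
     (\<forall>x\<in>{-1<..<1}. (1 - x) powr \<alpha> * (1 + x) powr \<beta> * poly p x =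
        (-1) ^ n / (2 ^ n * fact n) *
        (deriv ^^ n) (\<lambda>u. (1 - u) powr (\<alpha> + real n) * (1 + u) powr (\<beta> + real n)) x)"

definition jacobi_poly :: "real \<Rightarrow> real \<Rightarrow> nat \<Rightarrow> real poly" where
  "jacobi_poly \<alpha> \<beta> n = (THE p. is_jacobi_poly \<alpha> \<beta> n p)"

lemma jacobi_weight_higher_deriv:
  fixes a b :: real
  shows "\<exists>q. \<forall>x\<in>{-1<..<1}. (deriv ^^ k) (\<lambda>u. (1 - u) powr a * (1 + u) powr b) x =
           poly q x * ((1 - x) powr (a - real k) * (1 + x) powr (b - real k))"
proof (induction k)
  case 0
  show ?case by (intro exI[of _ 1]) simp
next
  case (Suc k)
  then obtain q where q: "\<And>x. x \<in> {-1<..<1} \<Longrightarrow>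
      (deriv ^^ k) (\<lambda>u. (1 - u) powr a * (1 + u) powr b) x =
      poly q x * ((1 - x) powr (a - real k) * (1 + x) powr (b - real k))" by blast
  define r where "r = pderiv q * ([:1, -1:] * [:1, 1:])
      + smult (- (a - real k)) (q * [:1, 1:]) + smult (b - real k) (q * [:1, -1:])"
  have "deriv ((deriv ^^ k) (\<lambda>u. (1 - u) powr a * (1 + u) powr b)) x =
      poly r x * ((1 - x) powr (a - real (Suc k)) * (1 + x) powr (b - real (Suc k)))"
    if x: "x \<in> {-1<..<1}" for x
  proof -
    define A where "A = (1 - x) powr (a - real (Suc k))"
    define B where "B = (1 + x) powr (b - real (Suc k))"
    have pos: "0 < 1 - x" "0 < 1 + x" using x by auto
    have A: "(1 - x) powr (a - real k) = (1 - x) * A" "(1 - x) powr (a - real k - 1) = A"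
      using pos powr_mult_base[of "1 - x" "a - real (Suc k)"]
      unfolding A_def by (simp_all add: algebra_simps)
    have B: "(1 + x) powr (b - real k) = (1 + x) * B" "(1 + x) powr (b - real k - 1) = B"
      using pos powr_mult_base[of "1 + x" "b - real (Suc k)"]
      unfolding B_def by (simp_all add: algebra_simps)
    have dA: "((\<lambda>u. (1 - u) powr (a - real k)) has_real_derivative - ((a - real k) * A)) (at x)"
    proof -
      have "((\<lambda>u. 1 - u) has_real_derivative -1) (at x)"
        by (auto intro!: derivative_eq_intros)
      from DERIV_chain2[where f = "\<lambda>z. z powr (a - real k)" and g = "\<lambda>u. 1 - u" and x = x and s = UNIV,
          OF has_real_derivative_powr[OF pos(1)] this]
      show ?thesis by (simp add: A)
    qed
    have dB: "((\<lambda>u. (1 + u) powr (b - real k)) has_real_derivative (b - real k) * B) (at x)"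
    proof -
      have "((\<lambda>u. 1 + u) has_real_derivative 1) (at x)"
        by (auto intro!: derivative_eq_intros)
      from DERIV_chain2[where f = "\<lambda>z. z powr (b - real k)" and g = "\<lambda>u. 1 + u" and x = x and s = UNIV,
          OF has_real_derivative_powr[OF pos(2)] this]
      show ?thesis by (simp add: B)
    qed
    have "((\<lambda>u. poly q u * ((1 - u) powr (a - real k) * (1 + u) powr (b - real k)))
        has_real_derivative poly r x * (A * B)) (at x)"
      by (rule derivative_eq_intros poly_DERIV dA dB refl)+
         (simp add: A B r_def algebra_simps)
    moreover have "eventually (\<lambda>u. poly q u * ((1 - u) powr (a - real k) * (1 + u) powr (b - real k)) =
        (deriv ^^ k) (\<lambda>u. (1 - u) powr a * (1 + u) powr b) u) (nhds x)"
      using eventually_nhds_in_open[of "{-1<..<1}" x] x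
      by (auto elim!: eventually_mono simp: q)
    ultimately have "((deriv ^^ k) (\<lambda>u. (1 - u) powr a * (1 + u) powr b)
        has_real_derivative poly r x * (A * B)) (at x)"
      using DERIV_cong_ev[OF refl _ refl] by fastforce
    thus ?thesis unfolding A_def B_def by (rule DERIV_imp_deriv)
  qed
  thus ?case by (intro exI[of _ r]) simp
qed

lemma jacobi_poly_exists: "\<exists>p. is_jacobi_poly \<alpha> \<beta> n p"
proof -
  obtain q where q: "\<And>x. x \<in> {-1<..<1} \<Longrightarrow>
      (deriv ^^ n) (\<lambda>u. (1 - u) powr (\<alpha> + real n) * (1 + u) powr (\<beta> + real n)) x =
      poly q x * ((1 - x) powr (\<alpha> + real n - real n) * (1 + x) powr (\<beta> + real n - real n))"
    using jacobi_weight_higher_deriv[where k = n and a = "\<alpha> + real n" and b = "\<beta> + real n"] by blast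
  have "is_jacobi_poly \<alpha> \<beta> n (smult ((-1) ^ n / (2 ^ n * fact n)) q)"
    unfolding is_jacobi_poly_def by (auto simp: q)
  thus ?thesis ..
qed

lemma jacobi_poly_unique:
  assumes "is_jacobi_poly \<alpha> \<beta> n p" "is_jacobi_poly \<alpha> \<beta> n q"
  shows "p = q"
proof -
  have "poly (p - q) x = 0" if "x \<in> {-1<..<1}" for x
  proof -
    have "(1 - x) powr \<alpha> * (1 + x) powr \<beta> * poly p x = (1 - x) powr \<alpha> * (1 + x) powr \<beta> * poly q x"
      using assms that unfolding is_jacobi_poly_def by simp
    thus ?thesis using that by simp
  qed
  hence "{-1<..<1} \<subseteq> {x. poly (p - q) x = 0}" by blast
  moreover have "infinite {-1<..<1::real}" by (simp add: infinite_Ioo)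
  ultimately have "p - q = 0" using poly_roots_finite finite_subset by blast
  thus ?thesis by simp
qed

lemma is_jacobi_poly_jacobi_poly: "is_jacobi_poly \<alpha> \<beta> n (jacobi_poly \<alpha> \<beta> n)"
  unfolding jacobi_poly_def
  using jacobi_poly_exists jacobi_poly_unique by (metis theI)

text \<open>
  At \<open>n = 0\<close> the factor $(\alpha+\beta+1)\,\Gamma(\alpha+\beta+1)$ of the general formula is read
  as $\Gamma(\alpha+\beta+2)$, which also covers \<open>\<alpha> + \<beta> = -1\<close>.
\<close>

definition jacobi_sq_norm :: "real \<Rightarrow> real \<Rightarrow> nat \<Rightarrow> real" where
  "jacobi_sq_norm \<alpha> \<beta> n =
     (if n = 0 then 2 powr (\<alpha> + \<beta> + 1) * (Gamma (\<alpha> + 1) * Gamma (\<beta> + 1) / Gamma (\<alpha> + \<beta> + 2))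
      else 2 powr (\<alpha> + \<beta> + 1) / (2 * real n + \<alpha> + \<beta> + 1) *
           (Gamma (real n + \<alpha> + 1) * Gamma (real n + \<beta> + 1) /
            (fact n * Gamma (real n + \<alpha> + \<beta> + 1))))"

end

(* The ladder satisfies Phi(phi(T)) = F(T) with F(T) the integral of Z^2 over [0, T] and
   Phi(y) the truncated Laplace integral. Since zeta does not vanish on any interval of the
   critical line, F is strictly increasing and Phi is strictly increasing with positive
   derivative wherever mu > 0; hence phi is continuous, strictly increasing and differentiable,
   and x = phi_1(t) - T - 1 is an admissible substitution that turns the integrals into the
   classical ones over [-1, 1]. Those follow from Rodrigues' formula by n-fold integration by
   parts and the Beta integral. As pi(t) = o(t), the standing fact gives phi_1(t) ~ t, which
   yields both the unboundedness of phi and the distance asymptotics. *)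

theory Submission
  imports Defs
begin

text \<open>The defining equation of a ladder is pointwise in \<open>T\<close>: by itself it says
  nothing about continuity, monotonicity or growth of \<open>\<phi>\<close>, and the difficulty is
  to obtain these without circularity. Growth comes from the standing fact; surjectivity is an
  intermediate value argument for F and not for \<open>\<phi>\<close>, whose continuity is a
  consequence of it; an implicit differentiation then only needs that continuity. Three degeneracies
  shape the statements. The bound \<open>7 * y * ln y\<close> is negative for \<open>y < 1\<close>,
  so \<open>\<mu>\<close> may be nonpositive near \<open>y0\<close>, and there Phi is identically 0.
  Zeta may vanish at single points, so \<open>\<phi>\<close> has only a nonnegative derivative, and
  the positivity of Phi' has to come from the exponential factor, not from the moving upper limit.
  For negative \<open>\<alpha>\<close> or \<open>\<beta>\<close> the weight is unbounded at the
  ends, so the change of variables is the one for absolutely integrable functions and injective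
  maps.\<close>

section \<open>The prime-counting function is o(x)\<close>

text \<open>Chebyshev's argument: the product of these primes divides \<open>2 * n choose n\<close>,
  which is at most \<open>2 ^ (2 * n)\<close>, while each factor is at least \<open>2 ^ j\<close>.
  Comparing exponents of 2 gives the bound.\<close>

lemma card_primes_doubling:
  assumes "2 ^ j \<le> n"
  shows "j * card {p::nat. prime p \<and> n < p \<and> p \<le> 2 * n} \<le> 2 * n"
proof -
  define S where "S = {p::nat. prime p \<and> n < p \<and> p \<le> 2 * n}"
  have fin: "finite S" unfolding S_def by (rule finite_subset[of _ "{..2 * n}"]) auto
  have dvd: "p dvd 2 * n choose n" if "p \<in> S" for p
  proof -
    have p: "prime p" "n < p" "p \<le> 2 * n" using that by (auto simp: S_def)
    have "p dvd fact (2 * n)" using p by (simp add: prime_dvd_fact_iff)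
    also have "fact (2 * n) = fact n * fact n * (2 * n choose n)"
      using binomial_fact_lemma[of n "2 * n"] by simp
    finally show ?thesis using p by (auto simp: prime_dvd_mult_iff prime_dvd_fact_iff)
  qed
  have sub: "(\<Prod>p\<in>T. p) dvd 2 * n choose n" if "T \<subseteq> S" "finite T" for T
    using that(2,1)
  proof (induction T rule: finite_induct)
    case (insert q T)
    have "coprime q (\<Prod>p\<in>T. p)"
      using insert by (intro prod_coprime_right primes_coprime) (auto simp: S_def)
    with insert dvd[of q] show ?case by (simp add: divides_mult)
  qed simp
  have "(2 ^ j) ^ card S = (\<Prod>p\<in>S. 2 ^ j :: nat)" by simp
  also have "\<dots> \<le> (\<Prod>p\<in>S. p)"
    by (intro prod_mono) (use assms in \<open>auto simp: S_def\<close>)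
  also have "\<dots> \<le> 2 * n choose n" by (rule dvd_imp_le[OF sub]) (use fin in auto)
  also have "\<dots> \<le> 2 ^ (2 * n)" by (rule binomial_le_pow2)
  finally show ?thesis unfolding S_def by (simp flip: power_mult)
qed

text \<open>Up to \<open>2 ^ j\<close> every positive integer is counted. Beyond that, the dyadic
  block above \<open>2 ^ k\<close> contributes at most \<open>2 * 2 ^ k\<close>, exactly the amount
  by which the last term grows from \<open>k\<close> to \<open>Suc k\<close>.\<close>

lemma card_primes_upto_power2:
  assumes "j \<le> k"
  shows "j * card {p::nat. prime p \<and> p \<le> 2 ^ k} \<le> j * 2 ^ j + 2 * 2 ^ k"
  using assms
proof (induction k rule: dec_induct)
  case base
  have "card {p::nat. prime p \<and> p \<le> 2 ^ j} \<le> card {0<..2 ^ j::nat}"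
    by (rule card_mono) (auto simp: prime_gt_0_nat)
  hence "j * card {p::nat. prime p \<and> p \<le> 2 ^ j} \<le> j * 2 ^ j"
    by (intro mult_le_mono2) simp
  thus ?case by linarith
next
  case (step k)
  have "{p::nat. prime p \<and> p \<le> 2 ^ Suc k} =
      {p. prime p \<and> p \<le> 2 ^ k} \<union> {p. prime p \<and> 2 ^ k < p \<and> p \<le> 2 * 2 ^ k}" by auto
  hence "card {p::nat. prime p \<and> p \<le> 2 ^ Suc k} \<le>
      card {p::nat. prime p \<and> p \<le> 2 ^ k} + card {p::nat. prime p \<and> 2 ^ k < p \<and> p \<le> 2 * 2 ^ k}"
    by (simp only: card_Un_le)
  hence "j * card {p::nat. prime p \<and> p \<le> 2 ^ Suc k} \<le> j * card {p::nat. prime p \<and> p \<le> 2 ^ k}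
      + j * card {p::nat. prime p \<and> 2 ^ k < p \<and> p \<le> 2 * 2 ^ k}"
    unfolding distrib_left[symmetric] by (rule mult_le_mono2)
  moreover have "j * card {p::nat. prime p \<and> 2 ^ k < p \<and> p \<le> 2 * 2 ^ k} \<le> 2 * 2 ^ k"
    using step.hyps by (intro card_primes_doubling power_increasing) simp_all
  ultimately show ?case using step.IH unfolding power_Suc by linarith
qed

lemma prime_counting_le:
  assumes "2 ^ j \<le> x"
  shows "real j * prime_counting x \<le> real j * 2 ^ j + 4 * x"
proof -
  have x1: "1 \<le> x" using assms one_le_power[of "2::real" j] by linarith
  \<comment> \<open>The least power of two above \<open>x\<close> is at most \<open>2 * x\<close>,
    which turns \<open>2 * 2 ^ k\<close> into \<open>4 * x\<close>.\<close>
  define k where "k = (LEAST k. x \<le> 2 ^ k)"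
  obtain k0 where "x \<le> 2 ^ k0" using real_arch_pow[of 2 x] by (auto intro: less_imp_le)
  hence k: "x \<le> 2 ^ k" unfolding k_def by (rule LeastI)
  have "(2::real) ^ j \<le> 2 ^ k" using assms k by linarith
  hence jk: "j \<le> k" by simp
  have k2: "2 ^ k \<le> 2 * x"
  proof (cases k)
    case 0
    thus ?thesis using x1 by simp
  next
    case (Suc i)
    have "\<not> x \<le> 2 ^ i" using not_less_Least[of i "\<lambda>k. x \<le> 2 ^ k"] Suc by (simp add: k_def)
    thus ?thesis using Suc by simp
  qed
  have "{p::nat. prime p \<and> real p \<le> x} \<subseteq> {p. prime p \<and> p \<le> 2 ^ k}"
  proof safe
    fix p :: nat assume "real p \<le> x"
    hence "real p \<le> real (2 ^ k)" using k by (simp only: of_nat_power of_nat_numeral)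
    thus "p \<le> 2 ^ k" by (rule of_nat_le_iff[THEN iffD1])
  qed
  hence "card {p::nat. prime p \<and> real p \<le> x} \<le> card {p::nat. prime p \<and> p \<le> 2 ^ k}"
    by (intro card_mono) (auto intro: finite_subset[of _ "{..2 ^ k}"])
  hence "j * card {p::nat. prime p \<and> real p \<le> x} \<le> j * 2 ^ j + 2 * 2 ^ k"
    using card_primes_upto_power2[OF jk] by (meson mult_le_mono2 le_trans)
  hence "real (j * card {p::nat. prime p \<and> real p \<le> x}) \<le> real (j * 2 ^ j + 2 * 2 ^ k)"
    by (rule of_nat_mono)
  thus ?thesis using k2 by (simp add: prime_counting_def)
qed

lemma prime_counting_smallo: "prime_counting \<in> o[at_top](\<lambda>x. x)"
proof (rule landau_o.smallI)
  fix c :: real assume c: "c > 0"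
  \<comment> \<open>Both terms of the bound are to be at most \<open>real j * (c * x / 2)\<close>:
    for \<open>4 * x\<close> this is \<open>j > 8 / c\<close>, for \<open>j * 2 ^ j\<close> it is
    the threshold \<open>x \<ge> 2 * 2 ^ j / c\<close>.\<close>
  obtain j :: nat where j: "8 / c < real j" using reals_Archimedean2 by blast
  have jpos: "real j > 0" using j c by (meson divide_pos_pos less_trans zero_less_numeral)
  have "eventually (\<lambda>x. 2 ^ j \<le> x \<and> 2 * 2 ^ j / c \<le> (x::real)) at_top"
    by (intro eventually_conj eventually_ge_at_top)
  thus "eventually (\<lambda>x. norm (prime_counting x) \<le> c * norm x) at_top"
  proof eventually_elim
    case (elim x)
    have x: "x > 0" using elim by (smt (verit) zero_less_power)
    have "real j * prime_counting x \<le> real j * 2 ^ j + 4 * x"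
      using elim by (intro prime_counting_le) auto
    also have "real j * 2 ^ j \<le> real j * (c * x / 2)"
      using elim c jpos by (intro mult_left_mono) (auto simp: field_simps)
    also have "4 * x \<le> real j * (c * x / 2)"
      using j c x by (simp add: field_simps)
    finally have "real j * prime_counting x \<le> real j * (c * x)" by (simp add: algebra_simps)
    hence "prime_counting x \<le> c * x" using jpos by simp
    thus ?case using x by (simp add: prime_counting_def)
  qed
qed

section \<open>Jacobi polynomials\<close>

text \<open>
  \<open>jacobi_core a b k\<close> is the polynomial left when the \<open>k\<close>-th derivative of
  $(1-x)^a(1+x)^b$ is divided by $(1-x)^{a-k}(1+x)^{b-k}$.
\<close>

fun jacobi_core :: "real \<Rightarrow> real \<Rightarrow> nat \<Rightarrow> real poly" where
  "jacobi_core a b 0 = 1"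
| "jacobi_core a b (Suc k) = pderiv (jacobi_core a b k) * ([:1, -1:] * [:1, 1:])
      + smult (- (a - real k)) (jacobi_core a b k * [:1, 1:])
      + smult (b - real k) (jacobi_core a b k * [:1, -1:])"

text \<open>The \<open>k\<close>-th derivative of the weight in closed form. Unlike the iterated
  \<open>deriv\<close>, the formula is also meaningful at -1 and 1, as integration by parts over the
  closed interval requires.\<close>

definition rodrigues :: "real \<Rightarrow> real \<Rightarrow> nat \<Rightarrow> real \<Rightarrow> real" where
  "rodrigues a b k x =
     poly (jacobi_core a b k) x * ((1 - x) powr (a - real k) * (1 + x) powr (b - real k))"

lemma rodrigues_has_derivative:
  assumes x: "x \<in> {-1<..<1}"
  shows "(rodrigues a b k has_real_derivative rodrigues a b (Suc k) x) (at x)"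
proof -
  \<comment> \<open>With the powers of exponent shifted by \<open>Suc k\<close> factored out, the
    product rule becomes a polynomial identity, namely the recursion of
    \<open>jacobi_core\<close>.\<close>
  define A where "A = (1 - x) powr (a - real (Suc k))"
  define B where "B = (1 + x) powr (b - real (Suc k))"
  have pos: "0 < 1 - x" "0 < 1 + x" using x by auto
  have A: "(1 - x) powr (a - real k) = (1 - x) * A" "(1 - x) powr (a - real k - 1) = A"
    using pos powr_mult_base[of "1 - x" "a - real (Suc k)"]
    unfolding A_def by (simp_all add: algebra_simps)
  have B: "(1 + x) powr (b - real k) = (1 + x) * B" "(1 + x) powr (b - real k - 1) = B"
    using pos powr_mult_base[of "1 + x" "b - real (Suc k)"]
    unfolding B_def by (simp_all add: algebra_simps)
  have dA: "((\<lambda>u. (1 - u) powr (a - real k)) has_real_derivative - ((a - real k) * A)) (at x)"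
    using pos by (auto intro!: derivative_eq_intros simp: A)
  have dB: "((\<lambda>u. (1 + u) powr (b - real k)) has_real_derivative (b - real k) * B) (at x)"
    using pos by (auto intro!: derivative_eq_intros simp: B)
  have "((\<lambda>u. poly (jacobi_core a b k) u * ((1 - u) powr (a - real k) * (1 + u) powr (b - real k)))
      has_real_derivative poly (jacobi_core a b (Suc k)) x * (A * B)) (at x)"
    by (rule derivative_eq_intros poly_DERIV dA dB refl)+
       (simp add: A B algebra_simps)
  thus ?thesis unfolding rodrigues_def A_def B_def .
qed

lemma higher_deriv_rodrigues:
  assumes "x \<in> {-1<..<1}"
  shows "(deriv ^^ k) (\<lambda>u. (1 - u) powr a * (1 + u) powr b) x = rodrigues a b k x"
  using assms
proof (induction k arbitrary: x)
  case 0
  show ?case by (simp add: rodrigues_def)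
next
  case (Suc k)
  have "eventually (\<lambda>u. (deriv ^^ k) (\<lambda>u. (1 - u) powr a * (1 + u) powr b) u = rodrigues a b k u) (nhds x)"
    using eventually_nhds_in_open[of "{-1<..<1}" x] Suc
    by (auto elim!: eventually_mono)
  hence "deriv ((deriv ^^ k) (\<lambda>u. (1 - u) powr a * (1 + u) powr b)) x = deriv (rodrigues a b k) x"
    by (rule deriv_cong_ev) simp
  thus ?case using DERIV_imp_deriv[OF rodrigues_has_derivative[OF Suc.prems]] by simp
qed

lemma jacobi_poly_eq:
  "jacobi_poly \<alpha> \<beta> n =
     smult ((-1) ^ n / (2 ^ n * fact n)) (jacobi_core (\<alpha> + real n) (\<beta> + real n) n)"
  by (rule jacobi_poly_unique[OF is_jacobi_poly_jacobi_poly])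
     (auto simp: is_jacobi_poly_def higher_deriv_rodrigues rodrigues_def)

section \<open>Degree and leading coefficient of the Rodrigues polynomials\<close>

lemma degree_jacobi_core_le: "degree (jacobi_core a b k) \<le> k"
proof (induction k)
  case (Suc k)
  have 1: "degree (p * [:1, c:]) \<le> Suc k" if "degree p \<le> k" for p :: "real poly" and c
    using degree_mult_le[of p "[:1, c:]"] that by (simp split: if_splits)
  have 2: "degree (pderiv (jacobi_core a b k) * ([:1, -1:] * [:1, 1:])) \<le> Suc k"
  \<comment> \<open>A constant is treated apart: \<open>degree_pderiv\<close> subtracts 1 in the
    naturals, so the product bound would give 2 instead of 1 at \<open>k = 0\<close>.\<close>
  proof (cases "degree (jacobi_core a b k) = 0")
    case True
    hence "pderiv (jacobi_core a b k) = 0" by (simp add: pderiv_eq_0_iff)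
    thus ?thesis by simp
  next
    case False
    have "degree (pderiv (jacobi_core a b k) * ([:1, -1:] * [:1, 1:]))
        \<le> degree (pderiv (jacobi_core a b k)) + degree ([:1, -1:] * [:1, 1::real:])"
      by (rule degree_mult_le)
    also have "\<dots> \<le> Suc k" using Suc False by (simp add: degree_pderiv)
    finally show ?thesis .
  qed
  show ?case
    unfolding jacobi_core.simps
    by (intro degree_add_le 1[OF Suc] 2 order_trans[OF degree_smult_le])
qed simp

text \<open>The three summands of the recursion multiply the top coefficient by \<open>- k\<close>,
  \<open>- (a - k)\<close> and \<open>- (b - k)\<close>, which add up to
  \<open>- (a + b - k)\<close>.\<close>

lemma coeff_jacobi_core: "coeff (jacobi_core a b k) k = (-1) ^ k * (\<Prod>i<k. a + b - real i)"
proof (induction k)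
  case (Suc k)
  define q where "q = jacobi_core a b k"
  have deg: "degree q \<le> k" unfolding q_def by (rule degree_jacobi_core_le)
  have 0: "coeff q i = 0" if "k < i" for i
    using deg that by (simp add: coeff_eq_0)
  have lin: "coeff (q * [:1, c:]) (Suc k) = c * coeff q k" for c
    by (simp add: 0)
  have "pderiv q * ([:1, -1:] * [:1, 1:]) = pderiv q - pCons 0 (pCons 0 (pderiv q))"
    by (simp add: algebra_simps)
  hence quad: "coeff (pderiv q * ([:1, -1:] * [:1, 1:])) (Suc k) = - (real k * coeff q k)"
    by (cases k) (simp_all add: coeff_pderiv 0)
  have "coeff (jacobi_core a b (Suc k)) (Suc k) = - (a + b - real k) * coeff q k"
    unfolding jacobi_core.simps q_def[symmetric] coeff_add coeff_smult lin quad
    by (simp add: algebra_simps)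
  thus ?case unfolding q_def Suc.IH by (simp add: algebra_simps)
qed simp

lemma prod_descending_Gamma:
  fixes z :: real
  assumes "z - real n + 1 > 0"
  shows "(\<Prod>i<n. z - real i) = Gamma (z + 1) / Gamma (z - real n + 1)"
  using assms
proof (induction n)
  case 0
  hence "Gamma (z + 1) \<noteq> 0" using Gamma_real_pos[of "z + 1"] by force
  thus ?case by simp
next
  case (Suc n)
  have pos: "z - real n > 0" using Suc.prems by simp
  hence "Gamma (z - real n + 1) = (z - real n) * Gamma (z - real n)"
    by (intro Gamma_plus1) (auto dest: nonpos_Ints_nonpos)
  moreover have "Gamma (z - real n) > 0" using pos by (rule Gamma_real_pos)
  moreover have "(\<Prod>i<n. z - real i) = Gamma (z + 1) / Gamma (z - real n + 1)"
    using Suc by simp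
  ultimately show ?case using pos by simp
qed

section \<open>Integrals against the Jacobi weight\<close>

lemma has_integral_Jacobi_weight:
  assumes a: "a > -1" and b: "b > (-1::real)"
  shows "((\<lambda>x. (1 - x) powr a * (1 + x) powr b)
      has_integral 2 powr (a + b + 1) * Beta (a + 1) (b + 1)) {-1..1}"
proof -
  have "((\<lambda>t. t powr b * (1 - t) powr a) has_integral Beta (b + 1) (a + 1)) (cbox 0 1)"
    using has_integral_Beta_real[of "b + 1" "a + 1"] a b by simp
  \<comment> \<open>The substitution is \<open>t = (x + 1) / 2\<close>; it contributes the factor 2,
    and rescaling the two powers contributes \<open>2 powr (a + b)\<close>.\<close>
  from has_integral_affinity'[OF this, of "1/2" "1/2"]
  have "((\<lambda>x. (x / 2 + 1 / 2) powr b * (1 - (x / 2 + 1 / 2)) powr a)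
      has_integral 2 * Beta (b + 1) (a + 1)) {-1..1}" by simp
  hence "((\<lambda>x. 2 powr (a + b) * ((x / 2 + 1 / 2) powr b * (1 - (x / 2 + 1 / 2)) powr a))
      has_integral 2 powr (a + b) * (2 * Beta (b + 1) (a + 1))) {-1..1}"
    by (rule has_integral_mult_right)
  also have "2 powr (a + b) * (2 * Beta (b + 1) (a + 1)) = 2 powr (a + b + 1) * Beta (a + 1) (b + 1)"
    by (simp add: powr_add Beta_commute)
  finally show ?thesis
  proof (rule has_integral_eq[rotated])
    fix x :: real assume x: "x \<in> {-1..1}"
    have "(1 + x) powr b = 2 powr b * (x / 2 + 1 / 2) powr b"
    proof -
      have "1 + x = 2 * (x / 2 + 1 / 2)" by simp
      thus ?thesis using x powr_mult[of 2 "x / 2 + 1 / 2" b] by (simp only:)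
    qed
    moreover have "(1 - x) powr a = 2 powr a * (1 - (x / 2 + 1 / 2)) powr a"
    proof -
      have "1 - x = 2 * (1 - (x / 2 + 1 / 2))" by simp
      thus ?thesis using x powr_mult[of 2 "1 - (x / 2 + 1 / 2)" a] by (simp only:)
    qed
    ultimately show "2 powr (a + b) * ((x / 2 + 1 / 2) powr b * (1 - (x / 2 + 1 / 2)) powr a)
        = (1 - x) powr a * (1 + x) powr b" by (simp add: powr_add)
  qed
qed

lemma poly_weight_absolutely_integrable:
  assumes "a > -1" and "b > (-1::real)"
  shows "(\<lambda>x. poly p x * ((1 - x) powr a * (1 + x) powr b)) absolutely_integrable_on {-1..1}"
proof (rule absolutely_integrable_bounded_measurable_product_real)
  show "poly p \<in> borel_measurable (lebesgue_on {-1..1})"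
    by (intro continuous_imp_measurable_on_sets_lebesgue continuous_on_poly continuous_on_id) simp
  show "bounded (poly p ` {-1..1})"
    by (intro compact_imp_bounded compact_continuous_image continuous_on_poly continuous_on_id) simp
  show "(\<lambda>x. (1 - x) powr a * (1 + x) powr b) absolutely_integrable_on {-1..1}"
    using has_integral_Jacobi_weight[OF assms]
    by (intro nonnegative_absolutely_integrable_1) (auto simp: has_integral_integrable)
qed simp

lemma rodrigues_by_parts:
  assumes ab: "a > real k" "b > real k"
    and I: "((\<lambda>x. poly (pderiv p) x * rodrigues a b k x) has_integral I) {-1..1}"
  shows "((\<lambda>x. poly p x * rodrigues a b (Suc k) x) has_integral - I) {-1..1}"
proof -
  have "((\<lambda>x. poly (pderiv p) x * rodrigues a b k x + rodrigues a b (Suc k) x * poly p x)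
      has_integral poly p 1 * rodrigues a b k 1 - poly p (-1) * rodrigues a b k (-1)) {-1..1}"
  proof (rule fundamental_theorem_of_calculus_interior)
    show "continuous_on {-1..1} (\<lambda>x. poly p x * rodrigues a b k x)"
      unfolding rodrigues_def using ab by (intro continuous_intros continuous_on_powr') auto
    show "((\<lambda>x. poly p x * rodrigues a b k x) has_vector_derivative
        poly (pderiv p) x * rodrigues a b k x + rodrigues a b (Suc k) x * poly p x) (at x)"
      if "x \<in> {-1<..<1}" for x
      using DERIV_mult[OF poly_DERIV rodrigues_has_derivative[OF that]]
      by (simp add: has_real_derivative_iff_has_vector_derivative)
  qed simp
  \<comment> \<open>The end values are 0 because \<open>0 powr _ = 0\<close>; that they agree with
    the limits is the continuity shown above, which rests on \<open>a > k\<close> and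
    \<open>b > k\<close>.\<close>
  moreover have "rodrigues a b k 1 = 0" "rodrigues a b k (-1) = 0"
    by (simp_all add: rodrigues_def)
  ultimately have "((\<lambda>x. poly (pderiv p) x * rodrigues a b k x + rodrigues a b (Suc k) x * poly p x)
      has_integral 0) {-1..1}" by simp
  from has_integral_diff[OF this I] show ?thesis by (simp add: mult.commute)
qed

text \<open>The last integration by parts has boundary terms of order \<open>k - 1\<close>, hence
  the bound \<open>k - 1\<close> on the exponents. For \<open>a = \<alpha> + k\<close> and
  \<open>b = \<beta> + k\<close> it says exactly \<open>\<alpha> > -1\<close> and
  \<open>\<beta> > -1\<close>.\<close>

lemma rodrigues_iterated_by_parts:
  assumes ab: "a > real k - 1" "b > real k - 1"
    and I: "((\<lambda>x. poly ((pderiv ^^ k) p) x * ((1 - x) powr a * (1 + x) powr b)) has_integral I) {-1..1}"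
  shows "((\<lambda>x. poly p x * rodrigues a b k x) has_integral (-1) ^ k * I) {-1..1}"
  using assms
proof (induction k arbitrary: p)
  case 0
  thus ?case by (simp add: rodrigues_def)
next
  case (Suc k)
  have "((\<lambda>x. poly (pderiv p) x * rodrigues a b k x) has_integral (-1) ^ k * I) {-1..1}"
    using Suc.prems by (intro Suc.IH) (auto simp: funpow_swap1)
  hence "((\<lambda>x. poly p x * rodrigues a b (Suc k) x) has_integral - ((-1) ^ k * I)) {-1..1}"
    using Suc.prems by (intro rodrigues_by_parts) auto
  thus ?case by simp
qed

lemma higher_pderiv_degree_le:
  fixes p :: "'a::{idom,semiring_char_0} poly"
  assumes "degree p \<le> n"
  shows "(pderiv ^^ n) p = [:fact n * coeff p n:]"
  using assms
proof (induction n arbitrary: p)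
  case 0
  then obtain c where "p = [:c:]" by (auto elim: degree_eq_zeroE)
  thus ?case by simp
next
  case (Suc n)
  have "(pderiv ^^ n) (pderiv p) = [:fact n * coeff (pderiv p) n:]"
    using Suc.prems by (intro Suc.IH) (simp add: degree_pderiv)
  thus ?case by (simp add: funpow_swap1 coeff_pderiv algebra_simps)
qed

text \<open>After \<open>n\<close> integrations by parts only the constant
  \<open>fact n * coeff p n\<close> is left of \<open>p\<close>. This serves orthogonality, where
  the coefficient is 0, as well as the norm, where \<open>p\<close> is the Jacobi polynomial
  itself.\<close>

lemma poly_jacobi_poly_has_integral:
  assumes \<alpha>: "\<alpha> > -1" and \<beta>: "\<beta> > -1" and deg: "degree p \<le> n"
  shows "((\<lambda>x. poly p x * poly (jacobi_poly \<alpha> \<beta> n) x * ((1 - x) powr \<alpha> * (1 + x) powr \<beta>))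
     has_integral coeff p n * 2 powr (\<alpha> + \<beta> + real n + 1)
        * Beta (\<alpha> + real n + 1) (\<beta> + real n + 1)) {-1..1}"
proof -
  let ?a = "\<alpha> + real n" and ?b = "\<beta> + real n"
  let ?B = "2 powr (?a + ?b + 1) * Beta (?a + 1) (?b + 1)"
  have "((\<lambda>x. (fact n * coeff p n) * ((1 - x) powr ?a * (1 + x) powr ?b))
      has_integral (fact n * coeff p n) * ?B) {-1..1}"
    using \<alpha> \<beta> by (intro has_integral_mult_right has_integral_Jacobi_weight) auto
  hence "((\<lambda>x. poly ((pderiv ^^ n) p) x * ((1 - x) powr ?a * (1 + x) powr ?b))
      has_integral (fact n * coeff p n) * ?B) {-1..1}"
    by (simp add: higher_pderiv_degree_le[OF deg])
  hence "((\<lambda>x. poly p x * rodrigues ?a ?b n x) has_integral (-1) ^ n * ((fact n * coeff p n) * ?B)) {-1..1}"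
    by (rule rodrigues_iterated_by_parts[rotated 2]) (use \<alpha> \<beta> in auto)
  from has_integral_mult_right[OF this, of "(-1) ^ n / (2 ^ n * fact n)"]
  have "((\<lambda>x. (-1) ^ n / (2 ^ n * fact n) * (poly p x * rodrigues ?a ?b n x)) has_integral
     (-1) ^ n / (2 ^ n * fact n) * ((-1) ^ n * ((fact n * coeff p n) * ?B))) {-1..1}" .
  also have "(\<lambda>x. (-1) ^ n / (2 ^ n * fact n) * (poly p x * rodrigues ?a ?b n x)) =
      (\<lambda>x. poly p x * poly (jacobi_poly \<alpha> \<beta> n) x * ((1 - x) powr \<alpha> * (1 + x) powr \<beta>))"
    by (simp add: jacobi_poly_eq rodrigues_def fun_eq_iff)
  also have "(-1) ^ n / (2 ^ n * fact n) * ((-1) ^ n * ((fact n * coeff p n) * ?B)) =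
      coeff p n * (2 powr (?a + ?b + 1) / 2 ^ n) * Beta (?a + 1) (?b + 1)"
    by (simp flip: power_add mult_2)
  also have "2 powr (?a + ?b + 1) / 2 ^ n = 2 powr (\<alpha> + \<beta> + real n + 1)"
    by (simp add: powr_diff[symmetric] powr_realpow[symmetric] add_ac)
  finally show ?thesis .
qed

lemma degree_jacobi_poly_le: "degree (jacobi_poly \<alpha> \<beta> n) \<le> n"
  unfolding jacobi_poly_eq using degree_jacobi_core_le degree_smult_le order_trans by blast

lemma coeff_jacobi_poly:
  "coeff (jacobi_poly \<alpha> \<beta> n) n = (\<Prod>i<n. \<alpha> + \<beta> + 2 * real n - real i) / (2 ^ n * fact n)"
proof -
  have "coeff (jacobi_poly \<alpha> \<beta> n) n =
      ((-1) ^ n * (-1) ^ n) * (\<Prod>i<n. \<alpha> + real n + (\<beta> + real n) - real i) / (2 ^ n * fact n)"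
    by (simp add: jacobi_poly_eq coeff_jacobi_core)
  thus ?thesis by (simp add: algebra_simps flip: power_add mult_2)
qed

lemma jacobi_poly_orthogonal:
  assumes "\<alpha> > -1" and "\<beta> > -1" and "m \<noteq> n"
  shows "((\<lambda>x. poly (jacobi_poly \<alpha> \<beta> m) x * poly (jacobi_poly \<alpha> \<beta> n) x *
      ((1 - x) powr \<alpha> * (1 + x) powr \<beta>)) has_integral 0) {-1..1}"
proof -
  have *: "((\<lambda>x. poly (jacobi_poly \<alpha> \<beta> m) x * poly (jacobi_poly \<alpha> \<beta> n) x *
      ((1 - x) powr \<alpha> * (1 + x) powr \<beta>)) has_integral 0) {-1..1}" if "m < n" for m n
  proof -
    have deg: "degree (jacobi_poly \<alpha> \<beta> m) < n"
      using degree_jacobi_poly_le[of \<alpha> \<beta> m] that by simp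
    show ?thesis
      using poly_jacobi_poly_has_integral[OF assms(1,2) less_imp_le[OF deg]]
      by (simp add: coeff_eq_0[OF deg])
  qed
  show ?thesis
  proof (cases "m < n")
    case False
    hence "n < m" using assms(3) by simp
    from *[OF this] show ?thesis by (simp add: mult.commute)
  qed (rule *)
qed

lemma jacobi_poly_sq_norm:
  assumes \<alpha>: "\<alpha> > -1" and \<beta>: "\<beta> > -1"
  shows "((\<lambda>x. (poly (jacobi_poly \<alpha> \<beta> n) x)\<^sup>2 * ((1 - x) powr \<alpha> * (1 + x) powr \<beta>))
     has_integral jacobi_sq_norm \<alpha> \<beta> n) {-1..1}"
proof -
  have "coeff (jacobi_poly \<alpha> \<beta> n) n * 2 powr (\<alpha> + \<beta> + real n + 1)
        * Beta (\<alpha> + real n + 1) (\<beta> + real n + 1) = jacobi_sq_norm \<alpha> \<beta> n"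
  \<comment> \<open>For \<open>n = 0\<close> the number \<open>\<alpha> + \<beta> + 1\<close> may be
    nonpositive, so the Beta value is used directly; for \<open>n \<ge> 1\<close> every Gamma
    argument below is positive.\<close>
  proof (cases "n = 0")
    case True
    thus ?thesis by (simp add: coeff_jacobi_poly jacobi_sq_norm_def Beta_def algebra_simps)
  next
    case False
    \<comment> \<open>\<open>s + 1\<close> is the factor
      \<open>2 * n + \<alpha> + \<beta> + 1\<close> of the norm: the leading coefficient brings
      \<open>Gamma (s + 1)\<close> into the numerator, the Beta function
      \<open>Gamma (s + 2)\<close> into the denominator.\<close>
    define s where "s = \<alpha> + \<beta> + 2 * real n"
    have n1: "real n \<ge> 1" using False by simp
    have s: "s + 1 > 0" "s - real n + 1 > 0" using \<alpha> \<beta> n1 unfolding s_def by linarith+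
    have "Gamma (s + 2) = (s + 1) * Gamma (s + 1)"
    proof -
      have "s + 1 \<notin> \<int>\<^sub>\<le>\<^sub>0" using s(1) nonpos_Ints_nonpos[of "s + 1"] by force
      thus ?thesis using Gamma_plus1[of "s + 1"] by (simp add: add.assoc)
    qed
    moreover have "Gamma (s + 1) > 0" "Gamma (s - real n + 1) > 0" using s by (auto intro: Gamma_real_pos)
    ultimately have q: "Gamma (s + 1) / Gamma (s - real n + 1) / Gamma (s + 2)
        = 1 / ((s + 1) * Gamma (s - real n + 1))" by simp
    have B: "Beta (\<alpha> + real n + 1) (\<beta> + real n + 1) =
        Gamma (real n + \<alpha> + 1) * Gamma (real n + \<beta> + 1) / Gamma (s + 2)"
      by (simp add: Beta_def s_def algebra_simps)
    have "2 powr (\<alpha> + \<beta> + real n + 1) = 2 powr (\<alpha> + \<beta> + 1) * 2 ^ n"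
      by (simp add: powr_realpow[symmetric] powr_add[symmetric] algebra_simps)
    hence "coeff (jacobi_poly \<alpha> \<beta> n) n * 2 powr (\<alpha> + \<beta> + real n + 1)
        * Beta (\<alpha> + real n + 1) (\<beta> + real n + 1) =
        2 powr (\<alpha> + \<beta> + 1) / fact n * (Gamma (real n + \<alpha> + 1) * Gamma (real n + \<beta> + 1)) *
         (Gamma (s + 1) / Gamma (s - real n + 1) / Gamma (s + 2))"
      unfolding coeff_jacobi_poly s_def[symmetric] prod_descending_Gamma[OF s(2)] B
      by (simp add: mult_ac)
    also have "\<dots> = jacobi_sq_norm \<alpha> \<beta> n"
      unfolding q using False by (simp add: jacobi_sq_norm_def s_def algebra_simps)
    finally show ?thesis .
  qed
  thus ?thesis
    using poly_jacobi_poly_has_integral[OF assms degree_jacobi_poly_le, of \<alpha> \<beta> n]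
    by (simp add: power2_eq_square)
qed

section \<open>Regularity of the ladder\<close>

abbreviation Z_sq :: "real \<Rightarrow> real" where
  "Z_sq t \<equiv> (norm (hardy_Z t))\<^sup>2"

lemma continuous_on_Z_sq [continuous_intros]: "continuous_on A Z_sq"
proof -
  have "zeta holomorphic_on {s. 0 < Re s} - {1}"
    using zeta_continuation_zeta by (simp add: is_zeta_continuation_def)
  hence "continuous_on ({s. 0 < Re s} - {1}) zeta"
    by (rule holomorphic_on_imp_continuous_on)
  moreover have "continuous_on A (\<lambda>t. Complex (1/2) t)"
    by (simp add: Complex_eq) (intro continuous_intros)
  ultimately have "continuous_on A (\<lambda>t. zeta (Complex (1/2) t))"
    by (rule continuous_on_compose2) (auto simp: complex_eq_iff)
  thus ?thesis unfolding norm_hardy_Z by (intro continuous_intros)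
qed

text \<open>A witness off the critical line for the identity theorem: at 2 the Dirichlet series has
  positive terms.\<close>

lemma zeta_2_nonzero: "zeta 2 \<noteq> 0"
proof
  assume 0: "zeta 2 = 0"
  have "(\<lambda>n. 1 / of_nat (Suc n) powr 2) sums zeta 2"
    using zeta_continuation_zeta unfolding is_zeta_continuation_def
    by (elim conjE allE[of _ 2] impE) simp_all
  moreover have "1 / of_nat (Suc n) powr 2 = complex_of_real (1 / real (Suc n) powr 2)" for n
    using powr_of_real[of "real (Suc n)" 2] by (simp del: of_nat_Suc)
  ultimately have "(\<lambda>n. complex_of_real (1 / real (Suc n) powr 2)) sums of_real 0"
    using 0 by (simp only: of_real_0)
  hence "(\<lambda>n. 1 / real (Suc n) powr 2) sums 0" by (simp only: sums_of_real_iff)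
  hence "summable (\<lambda>n. 1 / real (Suc n) powr 2)" "(\<Sum>n. 1 / real (Suc n) powr 2) = 0"
    by (simp_all only: sums_iff)
  hence "1 / real (Suc 0) powr 2 = 0"
    using suminf_eq_zero_iff[of "\<lambda>n. 1 / real (Suc n) powr 2"] by fastforce
  thus False by simp
qed

text \<open>Zeros filling a segment of the critical line would accumulate inside the connected
  domain of holomorphy, so zeta would vanish throughout it, in particular at 2.\<close>

lemma Z_sq_not_zero_on_interval:
  assumes "a < b"
  shows "\<exists>t\<in>{a..b}. Z_sq t \<noteq> 0"
proof (rule ccontr)
  assume "\<not> ?thesis"
  hence Z: "zeta (Complex (1/2) t) = 0" if "t \<in> {a..b}" for t
    using that by (simp add: norm_hardy_Z)
  define U where "U = Complex (1/2) ` {a..b}"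
  have "Complex (1/2) a islimpt U"
    unfolding islimpt_approachable
  proof (intro allI impI)
    fix e :: real assume e: "e > 0"
    define d where "d = min (e / 2) (b - a)"
    have d: "0 < d" "d < e" "d \<le> b - a" using e assms by (auto simp: d_def)
    have "Complex (1/2) (a + d) \<in> U" using d unfolding U_def by (intro imageI) simp
    moreover have "Complex (1/2) (a + d) \<noteq> Complex (1/2) a" using d by simp
    moreover have "dist (Complex (1/2) (a + d)) (Complex (1/2) a) < e"
      using d by (simp add: dist_norm complex_diff cmod_def)
    ultimately show "\<exists>x'\<in>U. x' \<noteq> Complex (1/2) a \<and> dist x' (Complex (1/2) a) < e" by blast
  qed
  moreover have "zeta holomorphic_on {s. 0 < Re s} - {1}"
    using zeta_continuation_zeta by (simp add: is_zeta_continuation_def)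
  moreover have "open ({s. 0 < Re s} - {1})" by (intro open_Diff open_halfspace_Re_gt) auto
  moreover have "connected ({s. 0 < Re s} - {1})"
    by (intro connected_open_delete open_halfspace_Re_gt convex_connected convex_halfspace_Re_gt) auto
  moreover have "U \<subseteq> {s. 0 < Re s} - {1}" by (auto simp: U_def complex_eq_iff)
  moreover have "Complex (1/2) a \<in> {s. 0 < Re s} - {1}" by (auto simp: complex_eq_iff)
  moreover have "zeta z = 0" if "z \<in> U" for z using that Z by (auto simp: U_def)
  moreover have "2 \<in> {s. 0 < Re s} - {1}" by auto
  ultimately have "zeta 2 = 0" 
    using analytic_continuation[of zeta "{s. 0 < Re s} - {1}" U "Complex (1/2) a" 2] by blast
  with zeta_2_nonzero show False by simp
qed

lemma integral_Z_sq_mult_pos: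
  assumes ab: "a < b" and h: "continuous_on {a..b} h"
    and nonneg: "\<And>t. t \<in> {a..b} \<Longrightarrow> 0 \<le> h t" and pos: "\<And>t. t \<in> {a<..b} \<Longrightarrow> 0 < h t"
  shows "0 < integral {a..b} (\<lambda>t. Z_sq t * h t)"
proof -
  have "continuous_on {a..b} (\<lambda>t. Z_sq t * h t)" by (intro continuous_intros h)
  note zero_iff = integral_eq_0_iff[OF this ab]
  \<comment> \<open>The point is sought in the right half because \<open>h\<close> may vanish at the
    left end, as the kernels used below do at \<open>t = 0\<close>.\<close>
  obtain t where "t \<in> {(a + b) / 2..b}" "Z_sq t \<noteq> 0"
    using Z_sq_not_zero_on_interval[of "(a + b) / 2" b] ab by auto
  hence "t \<in> {a..b}" "Z_sq t * h t \<noteq> 0" using ab pos[of t] by auto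
  hence "integral {a..b} (\<lambda>t. Z_sq t * h t) \<noteq> 0"
    using zero_iff nonneg by (meson mult_nonneg_nonneg zero_le_power2)
  moreover have "0 \<le> integral {a..b} (\<lambda>t. Z_sq t * h t)"
    by (rule integral_nonneg[OF integrable_continuous_real])
       (auto intro!: continuous_intros h mult_nonneg_nonneg nonneg)
  ultimately show ?thesis by simp
qed

lemma integral_Z_sq_strict_mono:
  assumes "0 \<le> s" "s < t"
  shows "integral {0..s} Z_sq < integral {0..t} Z_sq"
proof -
  have "integral {0..s} Z_sq + integral {s..t} Z_sq = integral {0..t} Z_sq"
    using assms by (intro Henstock_Kurzweil_Integration.integral_combine integrable_continuous_real
        continuous_intros) auto
  moreover have "0 < integral {s..t} Z_sq"
    using integral_Z_sq_mult_pos[of s t "\<lambda>_. 1"] assms by simp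
  ultimately show ?thesis by simp
qed

text \<open>Phi(y) is \<open>laplace_trunc y (\<mu> y)\<close>. Separating the decay parameter from
  the upper limit lets the two ways in which Phi depends on y be studied one at a time.\<close>

definition laplace_trunc :: "real \<Rightarrow> real \<Rightarrow> real" where
  "laplace_trunc y x = integral {0..x} (\<lambda>t. Z_sq t * exp (- (2 / y) * t))"

lemma laplace_trunc_mono:
  assumes "x \<le> x'"
  shows "laplace_trunc y x \<le> laplace_trunc y x'"
  unfolding laplace_trunc_def using assms
  by (intro integral_subset_le integrable_continuous_real continuous_intros) auto

lemma laplace_trunc_strict_mono:
  assumes "0 < x" "0 < y" "y < y'"
  shows "laplace_trunc y x < laplace_trunc y' x"
proof -
  have c: "continuous_on {0..x} (\<lambda>t. Z_sq t * exp (- (2 / z) * t))" for z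
    by (intro continuous_intros)
  have lt: "exp (- (2 / y) * t) < exp (- (2 / y') * t)" if "t > 0" for t
    using assms that by (simp add: frac_less2)
  have "0 < integral {0..x} (\<lambda>t. Z_sq t * (exp (- (2 / y') * t) - exp (- (2 / y) * t)))"
  proof (rule integral_Z_sq_mult_pos)
    show "0 \<le> exp (- (2 / y') * t) - exp (- (2 / y) * t)" if "t \<in> {0..x}" for t
      using lt[of t] that by (cases "t = 0") auto
    show "0 < exp (- (2 / y') * t) - exp (- (2 / y) * t)" if "t \<in> {0<..x}" for t
      using lt[of t] that by simp
  qed (use assms in \<open>auto intro!: continuous_intros\<close>)
  also have "\<dots> = laplace_trunc y' x - laplace_trunc y x"
    unfolding laplace_trunc_def right_diff_distrib
    by (intro integral_diff integrable_continuous_real c)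
  finally show ?thesis by simp
qed

lemma laplace_trunc_pos: "0 < x \<Longrightarrow> 0 < laplace_trunc y x"
  unfolding laplace_trunc_def by (intro integral_Z_sq_mult_pos continuous_intros) auto

lemma laplace_trunc_eq_0: "x \<le> 0 \<Longrightarrow> laplace_trunc y x = 0"
  by (cases "x = 0") (auto simp: laplace_trunc_def)

lemma laplace_trunc_deriv_parameter:
  assumes x: "0 < x" and y: "0 < y"
  shows "\<exists>A>0. ((\<lambda>y. laplace_trunc y x) has_real_derivative A) (at y)"
proof -
  let ?A = "\<lambda>y. integral (cbox 0 x) (\<lambda>t. Z_sq t * (2 * t / y\<^sup>2 * exp (- (2 / y) * t)))"
  have "((\<lambda>y. integral (cbox 0 x) (\<lambda>t. Z_sq t * exp (- (2 / y) * t))) has_field_derivative ?A y)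
      (at y within {0<..})"
  proof (rule leibniz_rule_field_derivative)
    show "((\<lambda>y. Z_sq t * exp (- (2 / y) * t)) has_field_derivative
        Z_sq t * (2 * t / z\<^sup>2 * exp (- (2 / z) * t))) (at z within {0<..})"
      if "z \<in> {0<..}" for z t
      using that by (auto intro!: derivative_eq_intros simp: power2_eq_square)
    show "continuous_on ({0<..} \<times> cbox 0 x)
        (\<lambda>(z, t). Z_sq t * (2 * t / z\<^sup>2 * exp (- (2 / z) * t)))"
      unfolding case_prod_unfold
      by (intro continuous_intros continuous_on_compose2[OF continuous_on_Z_sq[of UNIV]]) auto
    show "(\<lambda>t. Z_sq t * exp (- (2 / z) * t)) integrable_on cbox 0 x" for z
      unfolding cbox_interval by (intro integrable_continuous_real continuous_intros)
  qed (use y in auto)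
  moreover have "0 < ?A y"
    unfolding cbox_interval using x y
    by (intro integral_Z_sq_mult_pos) (auto intro!: continuous_intros)
  ultimately show ?thesis
    using y unfolding laplace_trunc_def
    by (intro exI[of _ "?A y"]) (simp add: at_within_open[of y "{0<..}"])
qed

lemma laplace_trunc_deriv_upper:
  assumes x: "0 < x"
  shows "(laplace_trunc y has_real_derivative Z_sq x * exp (- (2 / y) * x)) (at x)"
proof -
  have "((\<lambda>x. integral {0..x} (\<lambda>t. Z_sq t * exp (- (2 / y) * t))) has_real_derivative
      Z_sq x * exp (- (2 / y) * x)) (at x within {0..x + 1})"
    using x by (intro integral_has_real_derivative continuous_intros) auto
  moreover have "laplace_trunc y = (\<lambda>x. integral {0..x} (\<lambda>t. Z_sq t * exp (- (2 / y) * t)))"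
    by (simp add: laplace_trunc_def fun_eq_iff)
  ultimately show ?thesis
    using x at_within_interior[of x "{0..x + 1}"] by simp
qed

text \<open>By the chain rule the derivative is \<open>A\<close> plus \<open>Z_sq (\<mu> y)\<close>
  times an exponential times \<open>D\<close>. The second summand can vanish, so strict positivity
  is due to \<open>A\<close>, the derivative in the decay parameter.\<close>

lemma laplace_trunc_compose_has_derivative:
  assumes y: "0 < y" and \<mu>: "0 < \<mu> y" and d\<mu>: "(\<mu> has_real_derivative D) (at y)" and D: "0 \<le> D"
  shows "\<exists>E>0. ((\<lambda>y. laplace_trunc y (\<mu> y)) has_real_derivative E) (at y)"
proof -
  obtain A where A: "A > 0" "((\<lambda>z. laplace_trunc z (\<mu> y)) has_real_derivative A) (at y)"
    using laplace_trunc_deriv_parameter[OF \<mu> y] by blast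
  have mem: "(y, \<mu> y) \<in> {0<..} \<times> {0<..}" using y \<mu> by simp
  have op: "open ({0<..} \<times> {0<..} :: (real \<times> real) set)" by (intro open_Times open_greaterThan)
  define g where "g = (\<lambda>y x. Z_sq x * exp (- (2 / y) * x))"
  have "((\<lambda>(y, x). laplace_trunc y x) has_derivative
      (\<lambda>(ty, tx). A * ty + blinfun_mult_right (g y (\<mu> y)) tx)) (at (y, \<mu> y) within {0<..} \<times> {0<..})"
  \<comment> \<open>This criterion asks for continuity of the partial derivative in the upper limit;
    in the decay parameter it asks only for the derivative at the point itself.\<close>
  proof (rule has_derivative_partialsI)
    show "((\<lambda>z. laplace_trunc z (\<mu> y)) has_derivative (*) A) (at y within {0<..})"
      using A(2) has_derivative_at_withinI unfolding has_field_derivative_def by blast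
    show "(laplace_trunc z has_derivative blinfun_apply (blinfun_mult_right (g z x))) (at x within {0<..})"
      if "x \<in> {0<..}" for z x
      using laplace_trunc_deriv_upper[of x z] that unfolding has_field_derivative_def g_def
      by (auto intro: has_derivative_at_withinI)
    have "continuous_on ({0<..} \<times> {0<..}) (\<lambda>p. g (fst p) (snd p))"
      unfolding g_def
      by (intro continuous_intros continuous_on_compose2[OF continuous_on_Z_sq[of UNIV]]) auto
    hence "continuous_on ({0<..} \<times> {0<..}) (\<lambda>p. blinfun_mult_right (g (fst p) (snd p)))"
      by (rule bounded_linear.continuous_on[OF bounded_linear_blinfun_mult_right])
    from continuous_on_eq_continuous_within[THEN iffD1, OF this, rule_format, OF mem]
    show "continuous (at (y, \<mu> y) within {0<..} \<times> {0<..}) (\<lambda>(z, x). blinfun_mult_right (g z x))"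
      by (simp only: case_prod_unfold)
  qed (use \<mu> in auto)
  hence joint: "((\<lambda>(y, x). laplace_trunc y x) has_derivative
      (\<lambda>(ty, tx). A * ty + g y (\<mu> y) * tx)) (at (y, \<mu> y))"
    by (simp only: at_within_open[OF mem op] blinfun_mult_right.rep_eq)
  have "((\<lambda>y. (y, \<mu> y)) has_derivative (\<lambda>h. (h, D * h))) (at y)"
    using d\<mu> unfolding has_field_derivative_def by (intro has_derivative_Pair has_derivative_ident)
  from has_derivative_compose[OF this joint]
  have "((\<lambda>y. laplace_trunc y (\<mu> y)) has_derivative (\<lambda>h. A * h + g y (\<mu> y) * (D * h))) (at y)"
    by (simp only: case_prod_conv)
  also have "(\<lambda>h. A * h + g y (\<mu> y) * (D * h)) = (*) (A + g y (\<mu> y) * D)"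
    by (simp add: fun_eq_iff algebra_simps)
  finally have "((\<lambda>y. laplace_trunc y (\<mu> y)) has_real_derivative A + g y (\<mu> y) * D) (at y)"
    unfolding has_field_derivative_def .
  moreover have "A + g y (\<mu> y) * D > 0" using A(1) D by (simp add: g_def add_pos_nonneg)
  ultimately show ?thesis by blast
qed

text \<open>Caratheodory's factorisation of \<open>G\<close> avoids dividing by
  \<open>\<phi> s - \<phi> t\<close>: increments of \<open>F\<close> are \<open>g (\<phi> s)\<close>
  times those of \<open>\<phi>\<close>, and continuity of \<open>\<phi>\<close> makes
  \<open>g (\<phi> s)\<close> tend to \<open>E\<close>.\<close>

lemma has_real_derivative_implicit:
  fixes \<phi> :: "real \<Rightarrow> real"
  assumes G: "(G has_real_derivative E) (at (\<phi> t))" and E: "E \<noteq> 0"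
    and cont: "isCont \<phi> t"
    and eq: "eventually (\<lambda>s. G (\<phi> s) = F s) (nhds t)"
    and F: "(F has_real_derivative f) (at t)"
  shows "(\<phi> has_real_derivative f / E) (at t)"
proof -
  obtain g where g: "\<And>z. G z - G (\<phi> t) = g z * (z - \<phi> t)" "isCont g (\<phi> t)" "g (\<phi> t) = E"
    using G unfolding CARAT_DERIV by blast
  have "((\<lambda>s. (F s - F t) / (s - t)) \<longlongrightarrow> f) (at t)"
    using F by (simp add: has_field_derivative_iff)
  moreover have lim: "((\<lambda>s. g (\<phi> s)) \<longlongrightarrow> E) (at t)"
    using isCont_o2[OF cont g(2)] g(3) by (simp add: isCont_def)
  ultimately have "((\<lambda>s. ((F s - F t) / (s - t)) / g (\<phi> s)) \<longlongrightarrow> f / E) (at t)"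
    using E by (intro tendsto_divide)
  moreover have "eventually (\<lambda>s. ((F s - F t) / (s - t)) / g (\<phi> s) = (\<phi> s - \<phi> t) / (s - t)) (at t)"
  proof -
    have t: "G (\<phi> t) = F t" using eventually_nhds_x_imp_x[OF eq] .
    have "eventually (\<lambda>s. g (\<phi> s) \<noteq> 0) (at t)"
      using tendsto_imp_eventually_ne[OF lim E] .
    moreover have "eventually (\<lambda>s. G (\<phi> s) = F s) (at t)"
      using eq by (simp add: eventually_nhds_conv_at)
    ultimately show ?thesis
    proof eventually_elim
      case (elim s)
      have "F s - F t = g (\<phi> s) * (\<phi> s - \<phi> t)" using g(1)[of "\<phi> s"] elim t by simp
      thus ?case using elim by simp
    qed
  qed
  ultimately have "((\<lambda>s. (\<phi> s - \<phi> t) / (s - t)) \<longlongrightarrow> f / E) (at t)"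
    by (rule Lim_transform_eventually)
  thus ?thesis by (simp add: has_field_derivative_iff)
qed

text \<open>Unboundedness is separated from the defining equation because it is derived from the
  standing fact; it enters through the surjectivity of the ladder.\<close>

locale unbounded_jacob_ladder =
  fixes y0 t0 :: real and \<mu> \<phi> :: "real \<Rightarrow> real"
  assumes mu: "admissible_mu y0 \<mu>" and ladder: "jacob_ladder y0 \<mu> t0 \<phi>"
    and unbounded: "filterlim \<phi> at_top at_top"
begin

lemma y0_pos: "0 < y0" and mono_\<mu>: "mono_on {y0..} \<mu>" and t0_pos: "0 < t0"
  using mu ladder by (auto simp: admissible_mu_def jacob_ladder_def)

lemma ladder_ge: "t0 \<le> t \<Longrightarrow> y0 \<le> \<phi> t"
  using ladder by (simp add: jacob_ladder_def)

lemma ladder_eq: "t0 \<le> t \<Longrightarrow> laplace_trunc (\<phi> t) (\<mu> (\<phi> t)) = integral {0..t} Z_sq"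
  using ladder by (simp add: jacob_ladder_def laplace_trunc_def)

lemma \<mu>_differentiable: "y0 < y \<Longrightarrow> \<exists>D\<ge>0. (\<mu> has_real_derivative D) (at y)"
proof -
  assume y: "y0 < y"
  obtain D :: "nat \<Rightarrow> real \<Rightarrow> real" where D: "\<forall>y\<ge>y0. D 0 y = \<mu> y"
    "\<forall>k. \<forall>y\<ge>y0. (D k has_real_derivative D (Suc k) y) (at y within {y0..})"
    using mu unfolding admissible_mu_def smooth_on_halfline_def by (elim conjE exE)
  have int: "y \<in> interior {y0..}" using y by simp
  have "(D 0 has_real_derivative D (Suc 0) y) (at y)"
    using D(2)[rule_format, of y 0] y at_within_interior[OF int] by simp
  moreover have "eventually (\<lambda>z. D 0 z = \<mu> z) (nhds y)"
    using eventually_nhds_in_open[of "{y0<..}" y] y by (auto elim!: eventually_mono simp: D(1)[rule_format])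
  ultimately have "(\<mu> has_real_derivative D (Suc 0) y) (at y)"
    using DERIV_cong_ev by blast
  thus ?thesis using mono_on_imp_deriv_nonneg[OF mono_\<mu> _ int] by blast
qed

text \<open>Raising y weakens the decay and does not lower the upper limit. Positivity is asked of
  \<open>\<mu> y'\<close> only: if \<open>\<mu> y \<le> 0\<close>, the left side is 0 and the right
  side is positive.\<close>

lemma laplace_trunc_\<mu>_strict_mono:
  assumes "y0 \<le> y" "y < y'" "0 < \<mu> y'"
  shows "laplace_trunc y (\<mu> y) < laplace_trunc y' (\<mu> y')"
proof (cases "0 < \<mu> y")
  case True
  have "laplace_trunc y (\<mu> y) < laplace_trunc y' (\<mu> y)"
    using True assms y0_pos by (intro laplace_trunc_strict_mono) auto
  also have "\<dots> \<le> laplace_trunc y' (\<mu> y')"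
    using assms mono_\<mu> by (intro laplace_trunc_mono) (auto simp: mono_on_def)
  finally show ?thesis .
next
  case False
  thus ?thesis using laplace_trunc_pos[OF assms(3)] by (simp add: laplace_trunc_eq_0)
qed

lemma \<mu>_ladder_pos:
  assumes "t0 \<le> t"
  shows "0 < \<mu> (\<phi> t)"
proof (rule ccontr)
  assume "\<not> ?thesis"
  hence "integral {0..t} Z_sq = 0" using ladder_eq[OF assms] by (simp add: laplace_trunc_eq_0)
  thus False using integral_Z_sq_strict_mono[of 0 t] assms t0_pos by simp
qed

lemma ladder_strict_mono:
  assumes "t0 \<le> s" "s < t"
  shows "\<phi> s < \<phi> t"
proof (rule ccontr)
  assume "\<not> ?thesis"
  hence "\<phi> t = \<phi> s \<or> \<phi> t < \<phi> s" by auto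
  hence "laplace_trunc (\<phi> t) (\<mu> (\<phi> t)) \<le> laplace_trunc (\<phi> s) (\<mu> (\<phi> s))"
    using laplace_trunc_\<mu>_strict_mono[of "\<phi> t" "\<phi> s"] ladder_ge[of t] \<mu>_ladder_pos[of s] assms by force
  thus False
    using integral_Z_sq_strict_mono[of s t] assms t0_pos by (simp add: ladder_eq)
qed

text \<open>The intermediate value theorem is applied to the integral of \<open>Z_sq\<close>, whose
  continuity is known, with Phi(y) as the target; strict monotonicity of Phi then identifies
  \<open>\<phi> t\<close> with \<open>y\<close>.\<close>

lemma ladder_surj:
  assumes "\<phi> t0 < y"
  shows "\<exists>t>t0. \<phi> t = y"
proof -
  have "eventually (\<lambda>t. y \<le> \<phi> t \<and> t0 \<le> t) at_top"
    using unbounded by (intro eventually_conj eventually_ge_at_top) (simp add: filterlim_at_top)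
  then obtain t2 where t2: "y \<le> \<phi> t2" "t0 \<le> t2" by (auto simp: eventually_at_top_linorder)
  have y: "y0 \<le> y" using ladder_ge[of t0] assms by simp
  have "\<mu> (\<phi> t0) \<le> \<mu> y" using assms ladder_ge[of t0] mono_\<mu> by (auto simp: mono_on_def)
  hence \<mu>y: "0 < \<mu> y" using \<mu>_ladder_pos[of t0] by simp
  have "laplace_trunc (\<phi> t0) (\<mu> (\<phi> t0)) \<le> laplace_trunc y (\<mu> y)"
    using laplace_trunc_\<mu>_strict_mono[OF _ assms \<mu>y] ladder_ge[of t0] by simp
  moreover have "laplace_trunc y (\<mu> y) \<le> laplace_trunc (\<phi> t2) (\<mu> (\<phi> t2))"
    using laplace_trunc_\<mu>_strict_mono[of y "\<phi> t2"] y t2 \<mu>_ladder_pos[of t2] by force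
  moreover have "continuous_on {t0..t2} (\<lambda>t. integral {0..t} Z_sq)"
    using t0_pos
    by (intro continuous_on_subset[OF indefinite_integral_continuous_1[of Z_sq 0 t2]]
        integrable_continuous_real continuous_intros) auto
  ultimately obtain t where t: "t0 \<le> t" "t \<le> t2" "integral {0..t} Z_sq = laplace_trunc y (\<mu> y)"
    using IVT'[of "\<lambda>t. integral {0..t} Z_sq" t0 "laplace_trunc y (\<mu> y)" t2] t2
    by (auto simp: ladder_eq)
  have "\<phi> t = y"
  proof (rule linorder_cases[of "\<phi> t" y])
    assume "\<phi> t < y"
    thus ?thesis using laplace_trunc_\<mu>_strict_mono[of "\<phi> t" y] \<mu>y ladder_ge t ladder_eq by force
  next
    assume "y < \<phi> t"
    thus ?thesis using laplace_trunc_\<mu>_strict_mono[of y "\<phi> t"] y \<mu>_ladder_pos t ladder_eq by force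
  qed
  thus ?thesis using t assms by (intro exI[of _ t]) (cases "t = t0", auto)
qed

text \<open>A monotone function whose image is open has no jumps, and the open half-line is mapped
  onto an open half-line.\<close>

lemma ladder_continuous:
  assumes "t0 < t"
  shows "isCont \<phi> t"
proof -
  have "\<phi> ` {t0<..} = {\<phi> t0<..}"
    using ladder_strict_mono ladder_surj by (force simp: image_iff)
  hence "continuous_on {t0<..} \<phi>"
    using ladder_strict_mono by (intro continuous_onI_mono) (auto simp: less_le)
  thus ?thesis using assms by (simp add: continuous_on_eq_continuous_at)
qed

text \<open>The derivative is \<open>Z_sq t / E\<close> with \<open>E\<close> =
  Phi'(\<open>\<phi> t\<close>), twice the density of the substitution. It vanishes at zeros of
  zeta, hence \<open>D \<ge> 0\<close> and not \<open>D > 0\<close>.\<close>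

lemma ladder_has_derivative:
  assumes t: "t0 < t"
  shows "\<exists>D\<ge>0. (\<phi> has_real_derivative D) (at t)"
proof -
  have y: "y0 < \<phi> t" using ladder_ge[of t0] ladder_strict_mono[of t0 t] t by simp
  obtain D where "D \<ge> 0" "(\<mu> has_real_derivative D) (at (\<phi> t))"
    using \<mu>_differentiable[OF y] by blast
  then obtain E where E: "E > 0" "((\<lambda>y. laplace_trunc y (\<mu> y)) has_real_derivative E) (at (\<phi> t))"
    using laplace_trunc_compose_has_derivative[of "\<phi> t" \<mu> D] y y0_pos \<mu>_ladder_pos[of t] t by auto
  have "((\<lambda>t. integral {0..t} Z_sq) has_real_derivative Z_sq t) (at t within {0..t + 1})"
    using t t0_pos by (intro integral_has_real_derivative continuous_intros) auto
  hence F: "((\<lambda>t. integral {0..t} Z_sq) has_real_derivative Z_sq t) (at t)"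
    using t t0_pos at_within_interior[of t "{0..t + 1}"] by simp
  have "eventually (\<lambda>s. laplace_trunc (\<phi> s) (\<mu> (\<phi> s)) = integral {0..s} Z_sq) (nhds t)"
    using eventually_nhds_in_open[of "{t0<..}" t] t
    by (auto elim!: eventually_mono simp: ladder_eq)
  from has_real_derivative_implicit[OF E(2) _ ladder_continuous[OF t] this F]
  have "(\<phi> has_real_derivative Z_sq t / E) (at t)" using E(1) by simp
  moreover have "Z_sq t / E \<ge> 0" using E(1) by simp
  ultimately show ?thesis by blast
qed

end

section \<open>Orthogonality along the ladder\<close>

text \<open>Injectivity takes the place of a positive derivative, and absolute integrability admits
  an integrand with singular ends; the sign of \<open>D\<close> removes the absolute value from the
  general formula.\<close>

lemma has_integral_increasing_substitution:
  fixes f g :: "real \<Rightarrow> real"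
  assumes int: "f absolutely_integrable_on {-1..1}" "(f has_integral I) {-1..1}"
    and img: "g ` {a..b} = {-1..1}" and inj: "inj_on g {a..b}"
    and deriv: "\<And>t. t \<in> {a..b} \<Longrightarrow> (g has_real_derivative D t) (at t)"
    and nonneg: "\<And>t. t \<in> {a..b} \<Longrightarrow> 0 \<le> D t"
  shows "((\<lambda>t. f (g t) * D t) has_integral I) {a..b}"
proof -
  have "(\<lambda>t. \<bar>D t\<bar> * f (g t)) absolutely_integrable_on {a..b} \<and>
      integral {a..b} (\<lambda>t. \<bar>D t\<bar> * f (g t)) = I"
    using int img
    by (subst has_absolute_integral_change_of_variables_1'[OF _ has_field_derivative_at_within[OF deriv] inj])
       (auto simp: integral_unique)
  hence "((\<lambda>t. \<bar>D t\<bar> * f (g t)) has_integral I) {a..b}"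
    by (metis has_integral_integral set_lebesgue_integral_eq_integral(1))
  thus ?thesis by (rule has_integral_eq[rotated]) (simp add: nonneg)
qed

lemma setdist_unit_Icc:
  assumes "1 \<le> a" "a \<le> b"
  shows "setdist {-1..1} {a..b} = a - (1::real)"
proof (rule antisym)
  show "setdist {-1..1} {a..b} \<le> a - 1"
    using setdist_le_dist[of 1 "{-1..1}" a "{a..b}"] assms by (simp add: dist_real_def)
  show "a - 1 \<le> setdist {-1..1} {a..b}"
    using assms by (intro le_setdistI) (auto simp: dist_real_def)
qed

lemma jacob_ladder_half_asymp_equiv:
  assumes "(\<lambda>t. t - \<psi> t) \<sim>[at_top] (\<lambda>t. c * prime_counting t)"
  shows "\<psi> \<sim>[at_top] (\<lambda>t. t)"
proof -
  have "(\<lambda>t. t - \<psi> t) \<in> O[at_top](\<lambda>t. c * prime_counting t)"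
    using assms by (rule asymp_equiv_imp_bigo)
  also have "(\<lambda>t. c * prime_counting t) \<in> o[at_top](\<lambda>t. t)"
    using prime_counting_smallo by (cases "c = 0") auto
  finally have "(\<lambda>t. \<psi> t - t) \<in> o[at_top](\<lambda>t. t)"
    using landau_o.small.uminus_in_iff[of "\<lambda>t. t - \<psi> t"] by simp
  thus ?thesis by (simp add: asymp_equiv_altdef)
qed

section \<open>The inverse of the half ladder and the pull-back of integrals\<close>

context unbounded_jacob_ladder
begin

lemma half_ladder_less_iff:
  "t0 \<le> s \<Longrightarrow> t0 \<le> t \<Longrightarrow> \<phi> s / 2 < \<phi> t / 2 \<longleftrightarrow> s < t"
  using ladder_strict_mono[of s t] ladder_strict_mono[of t s] by (cases s t rule: linorder_cases) auto

text \<open>The strict inequality \<open>t0 < a\<close> keeps the segment inside the range where the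
  ladder is known to be continuous and differentiable from both sides.\<close>

lemma half_ladder_inv:
  assumes "\<phi> t0 / 2 < T"
  defines "a \<equiv> inv_into {t0..} (\<lambda>t. \<phi> t / 2) T"
  shows "t0 < a" "\<phi> a / 2 = T"
proof -
  obtain t where "t > t0" "\<phi> t = 2 * T" using ladder_surj[of "2 * T"] assms(1) by auto
  hence "T \<in> (\<lambda>t. \<phi> t / 2) ` {t0..}" by (intro image_eqI[of _ _ t]) auto
  from inv_into_into[OF this] f_inv_into_f[OF this]
  have a: "t0 \<le> a" "\<phi> a / 2 = T" by (simp_all add: a_def)
  show "\<phi> a / 2 = T" by (fact a)
  show "t0 < a" using a assms(1) by (cases "a = t0") auto
qed

lemma half_ladder_inv_at_top: "filterlim (inv_into {t0..} (\<lambda>t. \<phi> t / 2)) at_top at_top"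
  unfolding filterlim_at_top
proof
  fix K
  define k where "k = max K t0"
  have "eventually (\<lambda>T. max (\<phi> t0 / 2) (\<phi> k / 2) < T) at_top" by (rule eventually_gt_at_top)
  thus "eventually (\<lambda>T. K \<le> inv_into {t0..} (\<lambda>t. \<phi> t / 2) T) at_top"
  proof eventually_elim
    case (elim T)
    hence "\<phi> t0 / 2 < T" by simp
    note inv = half_ladder_inv[OF this]
    have "\<phi> k / 2 < \<phi> (inv_into {t0..} (\<lambda>t. \<phi> t / 2) T) / 2"
      using elim by (simp only: inv(2))
    hence "k < inv_into {t0..} (\<lambda>t. \<phi> t / 2) T"
      using half_ladder_less_iff inv(1) by (simp add: k_def)
    thus ?case by (simp add: k_def)
  qed
qed

lemma half_ladder_image:
  assumes "t0 < a" "a < b"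
  shows "(\<lambda>t. \<phi> t / 2) ` {a..b} = {\<phi> a / 2..\<phi> b / 2}"
proof
  show "(\<lambda>t. \<phi> t / 2) ` {a..b} \<subseteq> {\<phi> a / 2..\<phi> b / 2}"
    using ladder_strict_mono assms by (force simp: le_less)
  show "{\<phi> a / 2..\<phi> b / 2} \<subseteq> (\<lambda>t. \<phi> t / 2) ` {a..b}"
  proof
    fix y assume y: "y \<in> {\<phi> a / 2..\<phi> b / 2}"
    have "\<exists>t\<ge>a. t \<le> b \<and> \<phi> t / 2 = y"
      by (rule IVT) (use y assms ladder_continuous in \<open>auto intro!: continuous_intros\<close>)
    then obtain t where "t \<in> {a..b}" "y = \<phi> t / 2" by auto
    thus "y \<in> (\<lambda>t. \<phi> t / 2) ` {a..b}" by (rule image_eqI[rotated])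
  qed
qed

text \<open>Under \<open>x = \<psi> t - T - 1\<close> the factors \<open>1 - x\<close> and
  \<open>1 + x\<close> become \<open>T + 2 - \<psi> t\<close> and \<open>\<psi> t - T\<close>. A
  general \<open>p\<close> covers both products of two Jacobi polynomials and squares.\<close>

lemma poly_has_integral_half_ladder:
  fixes a b T \<alpha> \<beta> :: real and p :: "real poly"
  defines "\<psi> \<equiv> \<lambda>t. \<phi> t / 2"
  assumes ab: "t0 < a" "a < b" and ends: "\<psi> a = T" "\<psi> b = T + 2"
    and weights: "\<alpha> > -1" "\<beta> > -1"
    and I: "((\<lambda>x. poly p x * ((1 - x) powr \<alpha> * (1 + x) powr \<beta>)) has_integral I) {-1..1}"
  shows "((\<lambda>t. poly p (\<psi> t - T - 1) * ((T + 2 - \<psi> t) powr \<alpha> * (\<psi> t - T) powr \<beta> * deriv \<psi> t))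
           has_integral I) {a..b}"
proof -
  define g where "g = (\<lambda>t. \<psi> t - T - 1)"
  have d: "(\<psi> has_real_derivative deriv \<psi> t) (at t)" "0 \<le> deriv \<psi> t" if t: "t \<in> {a..b}" for t
  proof -
    obtain D where D: "D \<ge> 0" "(\<phi> has_real_derivative D) (at t)"
      using ladder_has_derivative[of t] t ab by auto
    have "(\<psi> has_real_derivative D / 2) (at t)"
      unfolding \<psi>_def using D(2) by (rule DERIV_cdivide)
    moreover from this have "deriv \<psi> t = D / 2" by (rule DERIV_imp_deriv)
    ultimately show "(\<psi> has_real_derivative deriv \<psi> t) (at t)" "0 \<le> deriv \<psi> t"
      using D(1) by auto
  qed
  have "\<psi> ` {a..b} = {T..T + 2}"
    using half_ladder_image[OF ab] ends unfolding \<psi>_def by simp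
  hence "(\<lambda>x. x + (- T - 1)) ` \<psi> ` {a..b} = {-1..1}" by (simp add: image_add_atLeastAtMost')
  hence img: "g ` {a..b} = {-1..1}" by (simp add: g_def image_image algebra_simps)
  have inj: "inj_on g {a..b}"
  proof (rule inj_onI)
    fix s t assume st: "s \<in> {a..b}" "t \<in> {a..b}" "g s = g t"
    hence "\<phi> s = \<phi> t" by (simp add: g_def \<psi>_def)
    thus "s = t"
      using half_ladder_less_iff[of s t] half_ladder_less_iff[of t s] st ab by auto
  qed
  have "((\<lambda>t. poly p (g t) * ((1 - g t) powr \<alpha> * (1 + g t) powr \<beta>) * deriv \<psi> t) has_integral I) {a..b}"
    by (rule has_integral_increasing_substitution[OF poly_weight_absolutely_integrable[OF weights] I img inj])
       (use d in \<open>auto simp: g_def intro!: derivative_eq_intros\<close>)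
  moreover have "1 - g t = T + 2 - \<psi> t" "1 + g t = \<psi> t - T" for t by (simp_all add: g_def)
  ultimately show ?thesis by (simp only: g_def mult.assoc)
qed

end

theorem mainTheorem1:
  fixes y0 t0 :: real and \<mu> \<phi> \<phi>\<^sub>1 :: "real \<Rightarrow> real"
  assumes mu: "admissible_mu y0 \<mu>"
    and ladder: "jacob_ladder y0 \<mu> t0 \<phi>"
    and phi1: "\<phi>\<^sub>1 = (\<lambda>t. \<phi> t / 2)"
    and standing_fact: "(\<lambda>t. t - \<phi>\<^sub>1 t) \<sim>[at_top] (\<lambda>t. (1 - euler_mascheroni) * prime_counting t)"
  shows "(\<exists>T0. \<forall>T\<ge>T0.
            (let a = inv_into {t0..} \<phi>\<^sub>1 T; b = inv_into {t0..} \<phi>\<^sub>1 (T + 2) in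
               \<phi>\<^sub>1 ` {a..b} = {T..T + 2} \<and>
               (\<forall>\<alpha>>-1. \<forall>\<beta>>-1.
                  (\<forall>t\<in>{a..b}. \<phi>\<^sub>1 t - T - 1 \<in> {-1..1}) \<and>
                  (\<forall>m n. m \<noteq> n \<longrightarrow>
                     ((\<lambda>t. poly (jacobi_poly \<alpha> \<beta> m) (\<phi>\<^sub>1 t - T - 1) *
                           poly (jacobi_poly \<alpha> \<beta> n) (\<phi>\<^sub>1 t - T - 1) *
                           ((T + 2 - \<phi>\<^sub>1 t) powr \<alpha> * (\<phi>\<^sub>1 t - T) powr \<beta> * deriv \<phi>\<^sub>1 t))
                      has_integral 0) {a..b}) \<and>
                  (\<forall>n. ((\<lambda>t. (poly (jacobi_poly \<alpha> \<beta> n) (\<phi>\<^sub>1 t - T - 1))\<^sup>2 *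
                             ((T + 2 - \<phi>\<^sub>1 t) powr \<alpha> * (\<phi>\<^sub>1 t - T) powr \<beta> * deriv \<phi>\<^sub>1 t))
                        has_integral jacobi_sq_norm \<alpha> \<beta> n) {a..b})))) \<and>
         (\<lambda>T. setdist {-1..1} {inv_into {t0..} \<phi>\<^sub>1 T..inv_into {t0..} \<phi>\<^sub>1 (T + 2)})
           \<sim>[at_top] (\<lambda>T. T)"
proof -
  have equiv: "\<phi>\<^sub>1 \<sim>[at_top] (\<lambda>t. t)"
    using standing_fact by (rule jacob_ladder_half_asymp_equiv)
  hence "filterlim \<phi>\<^sub>1 at_top at_top"
    using asymp_equiv_at_top_transfer asymp_equiv_symI filterlim_ident by blast
  hence "filterlim (\<lambda>t. 2 * \<phi>\<^sub>1 t) at_top at_top"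
    by (rule filterlim_tendsto_pos_mult_at_top[OF tendsto_const zero_less_numeral])
  hence unbounded: "filterlim \<phi> at_top at_top" by (simp add: phi1)
  interpret unbounded_jacob_ladder y0 t0 \<mu> \<phi>
    by unfold_locales (fact mu ladder unbounded)+
  define \<psi> where "\<psi> = inv_into {t0..} \<phi>\<^sub>1"
  have inv: "t0 < \<psi> T" "\<phi>\<^sub>1 (\<psi> T) = T" if "\<phi>\<^sub>1 t0 < T" for T
    using half_ladder_inv[of T] that unfolding \<psi>_def phi1 by auto
  have mono: "\<psi> T < \<psi> T'" if "\<phi>\<^sub>1 t0 < T" "T < T'" for T T'
    using half_ladder_less_iff[of "\<psi> T" "\<psi> T'"] inv[of T] inv[of T'] that unfolding phi1 by simp
  have "\<phi>\<^sub>1 ` {\<psi> T..\<psi> (T + 2)} = {T..T + 2} \<and>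
      (\<forall>\<alpha>>-1. \<forall>\<beta>>-1.
         (\<forall>t\<in>{\<psi> T..\<psi> (T + 2)}. \<phi>\<^sub>1 t - T - 1 \<in> {-1..1}) \<and>
         (\<forall>m n. m \<noteq> n \<longrightarrow>
            ((\<lambda>t. poly (jacobi_poly \<alpha> \<beta> m) (\<phi>\<^sub>1 t - T - 1) *
                  poly (jacobi_poly \<alpha> \<beta> n) (\<phi>\<^sub>1 t - T - 1) *
                  ((T + 2 - \<phi>\<^sub>1 t) powr \<alpha> * (\<phi>\<^sub>1 t - T) powr \<beta> * deriv \<phi>\<^sub>1 t))
             has_integral 0) {\<psi> T..\<psi> (T + 2)}) \<and>
         (\<forall>n. ((\<lambda>t. (poly (jacobi_poly \<alpha> \<beta> n) (\<phi>\<^sub>1 t - T - 1))\<^sup>2 *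
                    ((T + 2 - \<phi>\<^sub>1 t) powr \<alpha> * (\<phi>\<^sub>1 t - T) powr \<beta> * deriv \<phi>\<^sub>1 t))
               has_integral jacobi_sq_norm \<alpha> \<beta> n) {\<psi> T..\<psi> (T + 2)}))"
    if "\<phi>\<^sub>1 t0 + 1 \<le> T" for T
  proof -
    let ?a = "\<psi> T" and ?b = "\<psi> (T + 2)"
    \<comment> \<open>The threshold \<open>\<phi>\<^sub>1 t0 + 1\<close> is the witness for
      \<open>T0\<close>: it puts \<open>T\<close> and \<open>T + 2\<close> strictly above the value
      at \<open>t0\<close>, where the inverse is available.\<close>
    have T: "\<phi>\<^sub>1 t0 < T" "\<phi>\<^sub>1 t0 < T + 2" using that by auto
    have ab: "t0 < ?a" "?a < ?b" using inv(1)[OF T(1)] mono[of T "T + 2"] T by auto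
    have ends: "\<phi> ?a / 2 = T" "\<phi> ?b / 2 = T + 2"
      using inv(2)[OF T(1)] inv(2)[OF T(2)] by (simp_all add: phi1)
    have img: "\<phi>\<^sub>1 ` {?a..?b} = {T..T + 2}"
      using half_ladder_image[OF ab] unfolding phi1 ends .
    have range: "\<phi>\<^sub>1 t - T - 1 \<in> {-1..1}" if "t \<in> {?a..?b}" for t
      using imageI[OF that, of \<phi>\<^sub>1] unfolding img by auto
    note pull = poly_has_integral_half_ladder[OF ab ends]
    show ?thesis
    proof (intro conjI allI impI ballI)
      fix \<alpha> \<beta> :: real and m n :: nat
      assume w: "\<alpha> > -1" "\<beta> > -1" and "m \<noteq> n"
      show "((\<lambda>t. poly (jacobi_poly \<alpha> \<beta> m) (\<phi>\<^sub>1 t - T - 1) *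
                  poly (jacobi_poly \<alpha> \<beta> n) (\<phi>\<^sub>1 t - T - 1) *
                  ((T + 2 - \<phi>\<^sub>1 t) powr \<alpha> * (\<phi>\<^sub>1 t - T) powr \<beta> * deriv \<phi>\<^sub>1 t))
             has_integral 0) {?a..?b}"
        using pull[OF w, of "jacobi_poly \<alpha> \<beta> m * jacobi_poly \<alpha> \<beta> n" 0]
          jacobi_poly_orthogonal[OF w \<open>m \<noteq> n\<close>] by (simp add: phi1)
    next
      fix \<alpha> \<beta> :: real and n :: nat
      assume w: "\<alpha> > -1" "\<beta> > -1"
      show "((\<lambda>t. (poly (jacobi_poly \<alpha> \<beta> n) (\<phi>\<^sub>1 t - T - 1))\<^sup>2 *
                  ((T + 2 - \<phi>\<^sub>1 t) powr \<alpha> * (\<phi>\<^sub>1 t - T) powr \<beta> * deriv \<phi>\<^sub>1 t))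
             has_integral jacobi_sq_norm \<alpha> \<beta> n) {?a..?b}"
        using pull[OF w, of "(jacobi_poly \<alpha> \<beta> n)\<^sup>2"] jacobi_poly_sq_norm[OF w, of n]
        by (simp add: phi1 poly_power)
    qed (use img range in blast)+
  qed
  moreover have "(\<lambda>T. setdist {-1..1} {\<psi> T..\<psi> (T + 2)}) \<sim>[at_top] (\<lambda>T. T)"
  proof -
    have top: "filterlim \<psi> at_top at_top" unfolding \<psi>_def phi1 by (rule half_ladder_inv_at_top)
    have large: "eventually (\<lambda>T. \<phi>\<^sub>1 t0 < T) at_top" by (rule eventually_gt_at_top)
    have "eventually (\<lambda>T. 1 \<le> \<psi> T) at_top" using top by (simp add: filterlim_at_top)
    with large have "eventually (\<lambda>T. setdist {-1..1} {\<psi> T..\<psi> (T + 2)} = \<psi> T - 1) at_top"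
    proof eventually_elim
      case (elim T)
      thus ?case using mono[of T "T + 2"] by (intro setdist_unit_Icc) auto
    qed
    moreover have "eventually (\<lambda>T. T = \<phi>\<^sub>1 (\<psi> T)) at_top"
      using large by eventually_elim (simp add: inv(2))
    \<comment> \<open>The asymptotics of the inverse come from inserting
      \<open>t = \<psi> T\<close>, which tends to infinity, into \<open>\<phi>\<^sub>1 t\<close> ~
      \<open>t\<close>; the shift by 1 is absorbed.\<close>
    moreover have "(\<lambda>T. \<psi> T - 1) \<sim>[at_top] (\<lambda>T. \<phi>\<^sub>1 (\<psi> T))"
    proof -
      have "(\<lambda>x::real. x - 1) \<sim>[at_top] (\<lambda>x. x)"
      proof (rule smallo_imp_asymp_equiv, rule smalloI_tendsto)
        show "((\<lambda>x::real. (x - 1 - x) / x) \<longlongrightarrow> 0) at_top"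
          using tendsto_minus[OF tendsto_inverse_0_at_top[OF filterlim_ident]]
          by (simp add: field_simps)
        show "eventually (\<lambda>x::real. x \<noteq> 0) at_top"
          using eventually_gt_at_top[of 0] by eventually_elim simp
      qed
      from asymp_equiv_compose'[OF this top] asymp_equiv_symI[OF asymp_equiv_compose'[OF equiv top]]
      show ?thesis by (rule asymp_equiv_trans)
    qed
    ultimately show ?thesis by (subst asymp_equiv_cong)
  qed
  ultimately show ?thesis unfolding Let_def \<psi>_def by blast
qed

end
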